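(* For every $\xi\in(0,1/2)$ there exists a contraction $T$ on a Hilbert space (a bounded operator with $\|T\|\le 1$), with spectrum contained in $E_\xi$ (so that $T$ is invertible), such that $$\|T^{-n}\|=O\big(e^{n^{b(\xi)}}\big),\quad n\to+\infty,$$ and $$\limsup_{n\to+\infty}\frac{\|T^{-n}\|}{e^{n^{\beta}}}=+\infty\quad\text{for every real } \beta<b(\xi).$$
   Context: Hilbert spaces are complex. $\mathbb{T}$ is the unit circle in $\mathbb{C}$. For $\xi\in(0,1/2)$, the perfect symmetric set associated with $\xi$ is $$E_{\xi}=\Big\{\exp\Big(2i\pi(1-\xi)\sum_{n=1}^{+\infty}\epsilon_n\xi^{n-1}\Big):\ \epsilon_n\in\{0,1\}\ (n\ge 1)\Big\}\subset\mathbb{T},$$ and $$b(\xi)=\frac{\log\frac1\xi-\log 2}{2\log\frac1\xi-\log 2}.$$ *)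

theory Defs
  imports
    "HOL-Analysis.Analysis"
    "HOL-Library.Function_Algebras"
    "HOL-Library.Landau_Symbols"
begin

section \<open>Complex Hilbert spaces\<close>

text \<open>
  A Hilbert space is a linear subspace \<open>V\<close> of some complex vector space
  (library locale \<^locale>\<open>vector_space\<close>) with a complete inner product \<open>ip\<close>, linear in
  its first argument. The functions \<open>ip\<close> and, below, the operators are total functions
  on the ambient type; only their behaviour on \<open>V\<close> matters.

  An existential statement cannot range over types, so an ambient type has to be chosen
  when a Hilbert space is asserted to exist. The type \<^typ>\<open>nat \<Rightarrow> complex\<close> (with the
  pointwise addition of \<^theory>\<open>HOL-Library.Function_Algebras\<close>) has algebraic dimension
  continuum, so that all Hilbert spaces of at most that algebraic dimension, in particular
  all separable ones, occur as such a \<open>V\<close> up to isomorphism.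
\<close>

locale complex_inner_space = vector_space scale
  for scale :: "complex \<Rightarrow> 'a::ab_group_add \<Rightarrow> 'a" +
  fixes V :: "'a set" and ip :: "'a \<Rightarrow> 'a \<Rightarrow> complex"
  assumes subspace_V: "subspace V"
    and ip_add_left: "\<lbrakk>x \<in> V; y \<in> V; z \<in> V\<rbrakk> \<Longrightarrow> ip (x + y) z = ip x z + ip y z"
    and ip_scale_left: "\<lbrakk>x \<in> V; y \<in> V\<rbrakk> \<Longrightarrow> ip (scale c x) y = c * ip x y"
    and ip_commute: "\<lbrakk>x \<in> V; y \<in> V\<rbrakk> \<Longrightarrow> ip y x = cnj (ip x y)"
    and ip_self_nonneg: "x \<in> V \<Longrightarrow> 0 \<le> Re (ip x x)"
    and ip_self_eq_0: "\<lbrakk>x \<in> V; ip x x = 0\<rbrakk> \<Longrightarrow> x = 0"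
begin

definition nrm :: "'a \<Rightarrow> real"
  where "nrm x = sqrt (Re (ip x x))"

definition bounded_op :: "('a \<Rightarrow> 'a) \<Rightarrow> bool"
  where "bounded_op T \<longleftrightarrow>
    (\<forall>x\<in>V. T x \<in> V) \<and>
    (\<forall>x\<in>V. \<forall>y\<in>V. T (x + y) = T x + T y) \<and>
    (\<forall>c. \<forall>x\<in>V. T (scale c x) = scale c (T x)) \<and>
    (\<exists>K. \<forall>x\<in>V. nrm (T x) \<le> K * nrm x)"

definition opnorm :: "('a \<Rightarrow> 'a) \<Rightarrow> real"
  where "opnorm T = (SUP x\<in>{x \<in> V. nrm x \<le> 1}. nrm (T x))"

definition contraction :: "('a \<Rightarrow> 'a) \<Rightarrow> bool"
  where "contraction T \<longleftrightarrow> bounded_op T \<and> opnorm T \<le> 1"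

definition invertible_op :: "('a \<Rightarrow> 'a) \<Rightarrow> bool"
  where "invertible_op T \<longleftrightarrow>
    (\<exists>S. bounded_op S \<and> (\<forall>x\<in>V. S (T x) = x) \<and> (\<forall>x\<in>V. T (S x) = x))"

definition spectrum :: "('a \<Rightarrow> 'a) \<Rightarrow> complex set"
  where "spectrum T = {z. \<not> invertible_op (\<lambda>x. T x - scale z x)}"

text \<open>\<open>inv_pow T n\<close> is the operator written \<open>T\<^sup>-\<^sup>n\<close>; it is meaningful for invertible \<open>T\<close> only.\<close>

definition inv_pow :: "('a \<Rightarrow> 'a) \<Rightarrow> nat \<Rightarrow> 'a \<Rightarrow> 'a"
  where "inv_pow T n = inv_into V T ^^ n"

lemma nrm_scale_real: "x \<in> V \<Longrightarrow> nrm (scale (of_real r) x) = \<bar>r\<bar> * nrm x"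
proof -
  assume x: "x \<in> V"
  let ?y = "scale (of_real r) x"
  have y: "?y \<in> V" using subspace_scale[OF subspace_V x] .
  have "ip ?y ?y = of_real r * cnj (ip ?y x)"
    using ip_commute[OF y x] ip_scale_left[OF x y, of "of_real r"] by simp
  also have "\<dots> = of_real r * (of_real r * ip x x)"
    using ip_commute[OF x x] by (simp add: ip_scale_left[OF x x])
  finally have "Re (ip ?y ?y) = r\<^sup>2 * Re (ip x x)"
    by (simp add: power2_eq_square)
  then show ?thesis by (simp add: nrm_def real_sqrt_mult)
qed

text \<open>The defining supremum is over a bounded nonempty set, so it really is the operator norm.\<close>

lemma nrm_le_opnorm:
  assumes T: "bounded_op T" and x: "x \<in> V"
  shows "nrm (T x) \<le> opnorm T * nrm x"
proof -
  obtain K where K: "\<forall>x\<in>V. nrm (T x) \<le> K * nrm x"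
    using T by (auto simp: bounded_op_def)
  have bdd: "bdd_above ((\<lambda>x. nrm (T x)) ` {x \<in> V. nrm x \<le> 1})"
  proof (intro bdd_aboveI2)
    fix u assume u: "u \<in> {x \<in> V. nrm x \<le> 1}"
    then have "0 \<le> nrm u" using ip_self_nonneg by (auto simp: nrm_def)
    have "nrm (T u) \<le> K * nrm u" using u K by auto
    also have "K * nrm u \<le> \<bar>K\<bar> * nrm u"
      using \<open>0 \<le> nrm u\<close> by (intro mult_right_mono) auto
    also have "\<dots> \<le> \<bar>K\<bar> * 1"
      using u by (intro mult_left_mono) auto
    finally show "nrm (T u) \<le> \<bar>K\<bar>" by simp
  qed
  show ?thesis
  proof (cases "nrm x = 0")
    case True
    then show ?thesis using K x by force
  next
    case False
    then have pos: "0 < nrm x" using ip_self_nonneg[OF x] by (simp add: nrm_def)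
    define u where "u = scale (of_real (inverse (nrm x))) x"
    have u: "u \<in> V" unfolding u_def by (rule subspace_scale[OF subspace_V x])
    have "nrm u = 1" using pos by (simp add: u_def nrm_scale_real[OF x] del: of_real_inverse)
    then have "nrm (T u) \<le> opnorm T"
      unfolding opnorm_def using u by (intro cSUP_upper[OF _ bdd]) auto
    moreover have "T u = scale (of_real (inverse (nrm x))) (T x)"
      using T x by (simp add: u_def bounded_op_def)
    moreover have "T x \<in> V" using T x by (simp add: bounded_op_def)
    ultimately have "inverse (nrm x) * nrm (T x) \<le> opnorm T"
      using pos by (simp add: nrm_scale_real del: of_real_inverse)
    then show ?thesis using pos by (simp add: field_simps)
  qed
qed

lemma invertible_op_if_0_notin_spectrum: "0 \<notin> spectrum T \<Longrightarrow> invertible_op T"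
  by (simp add: spectrum_def)

text \<open>For an invertible \<open>T\<close>, \<^term>\<open>inv_into V T\<close> is the bounded two-sided inverse.\<close>

lemma invertible_op_inv_into:
  assumes T: "bounded_op T" and inv: "invertible_op T"
  shows "bounded_op (inv_into V T)"
    and "x \<in> V \<Longrightarrow> inv_into V T (T x) = x"
    and "x \<in> V \<Longrightarrow> T (inv_into V T x) = x"
proof -
  obtain S where S: "bounded_op S" "\<And>x. x \<in> V \<Longrightarrow> S (T x) = x" "\<And>x. x \<in> V \<Longrightarrow> T (S x) = x"
    using inv by (auto simp: invertible_op_def)
  have inj: "inj_on T V" using S(2) by (metis inj_onI)
  have SV: "S x \<in> V" if "x \<in> V" for x using S(1) that by (simp add: bounded_op_def)
  have eq: "inv_into V T x = S x" if "x \<in> V" for x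
    using inv_into_f_eq[OF inj SV S(3)] that by simp
  show "bounded_op (inv_into V T)"
    using S(1) subspace_add[OF subspace_V] subspace_scale[OF subspace_V]
    by (simp add: bounded_op_def eq)
  show "x \<in> V \<Longrightarrow> inv_into V T (T x) = x"
    using inv_into_f_f[OF inj] .
  show "x \<in> V \<Longrightarrow> T (inv_into V T x) = x"
    by (simp add: eq S(3))
qed

end

locale complex_hilbert_space = complex_inner_space +
  assumes complete:
    "\<lbrakk>\<And>n. \<sigma> n \<in> V; \<And>e. 0 < e \<Longrightarrow> \<exists>N. \<forall>m\<ge>N. \<forall>n\<ge>N. nrm (\<sigma> m - \<sigma> n) < e\<rbrakk>
      \<Longrightarrow> \<exists>l\<in>V. (\<lambda>n. nrm (\<sigma> n - l)) \<longlonglongrightarrow> 0"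

section \<open>Perfect symmetric sets\<close>

definition perfect_symmetric_set :: "real \<Rightarrow> complex set"
  where "perfect_symmetric_set \<xi> =
    {exp (2 * \<i> * of_real pi * of_real (1 - \<xi>) * of_real (\<Sum>n. \<epsilon> (Suc n) * \<xi> ^ n)) | \<epsilon> :: nat \<Rightarrow> real.
      \<forall>n\<ge>1. \<epsilon> n \<in> {0, 1}}"

definition b_exponent :: "real \<Rightarrow> real"
  where "b_exponent \<xi> = (ln (1 / \<xi>) - ln 2) / (2 * ln (1 / \<xi>) - ln 2)"

lemma perfect_symmetric_set_subset_circle: "perfect_symmetric_set \<xi> \<subseteq> sphere 0 1"
  by (auto simp: perfect_symmetric_set_def norm_exp_eq_Re)

end

(*
Let S = exp(-kappa H) be the singular inner function whose measure is the Cantor measure on E_xi,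
H being the Herglotz transform of that measure, and let T be the backward shift restricted to the
orthogonal complement of S H^2. For mu outside E_xi, S continues analytically to mu and the
multiplier U with (z - mu) U = 1 - S / S(mu) is bounded, so it provides an inverse of T - mu.

The norm of T^-n is governed by the Taylor coefficients c of 1/S: it is at most
1 + n (|c_0| + ... + |c_(n-1)|), and applying T^-n to the conjugated backward shift of S, which lies
in the space because S is inner, produces -c_(n-1) as a coordinate. Let alpha = ln 2 / ln (1/xi).
Then Re H(z) is at most of order (1 - |z|)^(alpha - 1), and this order is attained along z = 1 - xi^K;
optimising the Cauchy estimate |c_n| <= r^-n sup_{|z| = r} exp(kappa Re H) over r gives the exponent
(1 - alpha) / (2 - alpha) = b(xi), with a constant that is small for small kappa, while coefficients
of growth exp(n^beta) with beta < b(xi) would contradict the size of 1/S near z = 1.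
*)
theory Submission
  imports Defs "HOL-Complex_Analysis.Complex_Analysis" "HOL-Real_Asymp.Real_Asymp"
begin

section \<open>Square-summable sequences\<close>

text \<open>The Cantor measure is not built as a measure. Averages over the left end points of level
  \<open>N\<close> replace it; on Lipschitz functions they converge at the rate \<xi>^N, and the
  bounds on Re H are proved for all fine enough averages and then passed to the limit. Boundary
  values are avoided as well: the Hardy space is the space of square-summable coefficients, Parseval
  is applied on circles of radius r < 1, and being inner means |S| \<le> 1 together with coefficient
  norm 1. That norm is 1 because the Cantor set is null, which is one place where \<xi> < 1/2
  enters. Operators are transposes of multiplications for the pairing that sums products without
  conjugation, so that they commute because power series do. The factor \<open>n\<close> in the norm
  bound would spoil O(exp(n^b)) if the coefficients of 1/S were themselves of that size. The mass
  \<kappa> is free, and it is chosen so that they stay below exp(n^b / 4).\<close>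

definition l2 :: "(nat \<Rightarrow> complex) set"
  where "l2 = {f. summable (\<lambda>j. (cmod (f j))\<^sup>2)}"

definition l2norm :: "(nat \<Rightarrow> complex) \<Rightarrow> real"
  where "l2norm f = sqrt (\<Sum>j. (cmod (f j))\<^sup>2)"

lemma l2norm_nonneg [simp]: "f \<in> l2 \<Longrightarrow> 0 \<le> l2norm f"
  unfolding l2norm_def l2_def by (simp add: suminf_nonneg)

lemma l2norm_sq: "f \<in> l2 \<Longrightarrow> (l2norm f)\<^sup>2 = (\<Sum>j. (cmod (f j))\<^sup>2)"
  unfolding l2norm_def l2_def by (simp add: suminf_nonneg)

lemma l2_partial:
  assumes "f \<in> l2" and "finite J"
  shows "L2_set (\<lambda>j. cmod (f j)) J \<le> l2norm f"
  using assms unfolding L2_set_def l2norm_def l2_def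
  by (auto intro!: sum_le_suminf)

text \<open>Finite inequalities for \<open>L2_set\<close> pass to sequences through this criterion,
  which yields membership and the norm bound at the same time.\<close>

lemma l2_bound:
  assumes "\<And>n. L2_set (\<lambda>j. cmod (f j)) {..<n} \<le> B"
  shows "f \<in> l2" and "l2norm f \<le> B"
proof -
  have B: "0 \<le> B" using assms[of 0] by simp
  have le: "(\<Sum>j<n. (cmod (f j))\<^sup>2) \<le> B\<^sup>2" for n
    using assms[of n] B unfolding L2_set_def
    by (metis real_sqrt_le_iff real_sqrt_unique real_sqrt_abs abs_of_nonneg)
  have s: "summable (\<lambda>j. (cmod (f j))\<^sup>2)"
    by (rule summableI_nonneg_bounded[OF _ le]) simp
  then show "f \<in> l2" by (simp add: l2_def)
  have "(\<Sum>j. (cmod (f j))\<^sup>2) \<le> B\<^sup>2" by (rule suminf_le_const[OF s le])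
  then show "l2norm f \<le> B" unfolding l2norm_def using B real_le_lsqrt by blast
qed

lemma l2_coord: "f \<in> l2 \<Longrightarrow> cmod (f j) \<le> l2norm f"
  using l2_partial[of f "{j}"] by simp

lemma l2_add:
  assumes "f \<in> l2" and "g \<in> l2"
  shows "(\<lambda>j. f j + g j) \<in> l2" and "l2norm (\<lambda>j. f j + g j) \<le> l2norm f + l2norm g"
proof -
  have "L2_set (\<lambda>j. cmod (f j + g j)) {..<n} \<le> l2norm f + l2norm g" for n
  proof -
    have "L2_set (\<lambda>j. cmod (f j + g j)) {..<n} \<le> L2_set (\<lambda>j. cmod (f j) + cmod (g j)) {..<n}"
      by (intro L2_set_mono norm_triangle_ineq) auto
    also have "\<dots> \<le> L2_set (\<lambda>j. cmod (f j)) {..<n} + L2_set (\<lambda>j. cmod (g j)) {..<n}"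
      by (rule L2_set_triangle_ineq)
    also have "\<dots> \<le> l2norm f + l2norm g"
      by (intro add_mono l2_partial assms) auto
    finally show ?thesis .
  qed
  from l2_bound[of "\<lambda>j. f j + g j", OF this]
  show "(\<lambda>j. f j + g j) \<in> l2" and "l2norm (\<lambda>j. f j + g j) \<le> l2norm f + l2norm g" .
qed

lemma l2_scale:
  assumes "f \<in> l2"
  shows "(\<lambda>j. c * f j) \<in> l2" and "l2norm (\<lambda>j. c * f j) = cmod c * l2norm f"
proof -
  have s: "summable (\<lambda>j. (cmod (f j))\<^sup>2)" using assms by (simp add: l2_def)
  show "(\<lambda>j. c * f j) \<in> l2"
    using summable_mult[OF s, of "(cmod c)\<^sup>2"] by (simp add: l2_def norm_mult power_mult_distrib)
  show "l2norm (\<lambda>j. c * f j) = cmod c * l2norm f"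
    using s by (simp add: l2norm_def norm_mult power_mult_distrib suminf_mult real_sqrt_mult)
qed

lemma l2_diff:
  assumes "f \<in> l2" and "g \<in> l2"
  shows "(\<lambda>j. f j - g j) \<in> l2" and "l2norm (\<lambda>j. f j - g j) \<le> l2norm f + l2norm g"
  using l2_add[OF assms(1) l2_scale(1)[OF assms(2), of "-1"]] l2_scale(2)[OF assms(2), of "-1"]
  by auto

lemma l2_cnj: "f \<in> l2 \<Longrightarrow> (\<lambda>j. cnj (f j)) \<in> l2" "l2norm (\<lambda>j. cnj (f j)) = l2norm f"
  by (auto simp: l2_def l2norm_def)

lemma l2_shift:
  assumes "f \<in> l2"
  shows "(\<lambda>j. f (j + k)) \<in> l2" and "l2norm (\<lambda>j. f (j + k)) \<le> l2norm f"
proof -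
  have "L2_set (\<lambda>j. cmod (f (j + k))) {..<n} \<le> l2norm f" for n
  proof -
    have "L2_set (\<lambda>j. cmod (f (j + k))) {..<n} = L2_set (\<lambda>j. cmod (f j)) {k..<n+k}"
      unfolding L2_set_def
      by (rule arg_cong[where f = sqrt], rule sum.reindex_bij_witness[of _ "\<lambda>j. j - k" "\<lambda>j. j + k"]) auto
    then show ?thesis using l2_partial[OF assms, of "{k..<n+k}"] by simp
  qed
  from l2_bound[of "\<lambda>j. f (j + k)", OF this]
  show "(\<lambda>j. f (j + k)) \<in> l2" and "l2norm (\<lambda>j. f (j + k)) \<le> l2norm f" .
qed

lemma l2_finite_support: "(\<And>j. j \<ge> N \<Longrightarrow> f j = 0) \<Longrightarrow> f \<in> l2"
  unfolding l2_def by (auto intro!: summable_finite[of "{..<N}"]) (meson not_le)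

lemma l2_mult:
  assumes "f \<in> l2" and "g \<in> l2"
  shows "summable (\<lambda>j. cmod (f j * g j))" and "summable (\<lambda>j. f j * g j)"
    and "cmod (\<Sum>j. f j * g j) \<le> l2norm f * l2norm g"
proof -
  have le: "(\<Sum>j<n. cmod (f j * g j)) \<le> l2norm f * l2norm g" for n
  proof -
    have "(\<Sum>j<n. cmod (f j * g j)) \<le> L2_set (\<lambda>j. cmod (f j)) {..<n} * L2_set (\<lambda>j. cmod (g j)) {..<n}"
      using L2_set_mult_ineq[of "\<lambda>j. cmod (f j)" "\<lambda>j. cmod (g j)" "{..<n}"] by (simp add: norm_mult)
    also have "\<dots> \<le> l2norm f * l2norm g"
      using assms by (intro mult_mono l2_partial) auto
    finally show ?thesis .
  qed
  show s: "summable (\<lambda>j. cmod (f j * g j))"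
    by (rule summableI_nonneg_bounded[OF _ le]) simp
  then show "summable (\<lambda>j. f j * g j)" by (rule summable_norm_cancel)
  have "cmod (\<Sum>j. f j * g j) \<le> (\<Sum>j. cmod (f j * g j))" by (rule summable_norm[OF s])
  also have "\<dots> \<le> l2norm f * l2norm g" by (rule suminf_le_const[OF s le])
  finally show "cmod (\<Sum>j. f j * g j) \<le> l2norm f * l2norm g" .
qed

lemma l2_truncate:
  assumes "f \<in> l2"
  shows "(\<lambda>N. l2norm (\<lambda>j. if j < N then 0 else f j)) \<longlonglongrightarrow> 0"
proof -
  have s: "summable (\<lambda>j. (cmod (f j))\<^sup>2)" using assms by (simp add: l2_def)
  have eq: "l2norm (\<lambda>j. if j < N then 0 else f j) = sqrt (\<Sum>j. (cmod (f (j + N)))\<^sup>2)" for N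
  proof -
    let ?g = "\<lambda>j. if j < N then 0 else f j"
    have "?g \<in> l2" using l2_diff(1)[OF assms l2_finite_support[of N "\<lambda>j. if j < N then f j else 0"]]
      by (auto simp: if_distrib cong: if_cong)
    then have "summable (\<lambda>j. (cmod (?g j))\<^sup>2)" by (simp add: l2_def)
    from suminf_split_initial_segment[OF this, of N]
    show ?thesis by (simp add: l2norm_def)
  qed
  have "(\<lambda>N. \<Sum>j. (cmod (f (j + N)))\<^sup>2) \<longlonglongrightarrow> 0"
    by (rule suminf_exist_split2[OF s])
  from tendsto_real_sqrt[OF this] show ?thesis by (simp add: eq)
qed

text \<open>The limit is taken coordinatewise, so the norm estimate is first recovered on each
  finite section, letting \<open>n\<close> tend to infinity there, and only then does the section
  grow.\<close>

lemma l2_complete: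
  fixes \<sigma> :: "nat \<Rightarrow> nat \<Rightarrow> complex"
  assumes \<sigma>: "\<And>n. \<sigma> n \<in> l2"
    and cau: "\<And>e. 0 < e \<Longrightarrow> \<exists>N. \<forall>m\<ge>N. \<forall>n\<ge>N. l2norm (\<lambda>j. \<sigma> m j - \<sigma> n j) < e"
  obtains l where "l \<in> l2" and "(\<lambda>n. l2norm (\<lambda>j. \<sigma> n j - l j)) \<longlonglongrightarrow> 0"
proof -
  have "Cauchy (\<lambda>n. \<sigma> n j)" for j
  proof (rule CauchyI)
    fix e :: real assume "0 < e"
    from cau[OF this] obtain N where N: "\<forall>m\<ge>N. \<forall>n\<ge>N. l2norm (\<lambda>j. \<sigma> m j - \<sigma> n j) < e" by blast
    show "\<exists>N. \<forall>m\<ge>N. \<forall>n\<ge>N. norm (\<sigma> m j - \<sigma> n j) < e"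
      using N l2_coord[OF l2_diff(1)[OF \<sigma> \<sigma>]] by (meson le_less_trans)
  qed
  then have "\<forall>j. \<exists>c. (\<lambda>n. \<sigma> n j) \<longlonglongrightarrow> c" by (simp add: Cauchy_convergent_iff convergent_def)
  then obtain l where l: "\<And>j. (\<lambda>n. \<sigma> n j) \<longlonglongrightarrow> l j" by metis
  have tail: "(\<lambda>j. \<sigma> m j - l j) \<in> l2 \<and> l2norm (\<lambda>j. \<sigma> m j - l j) \<le> e"
    if N: "\<forall>m\<ge>N. \<forall>n\<ge>N. l2norm (\<lambda>j. \<sigma> m j - \<sigma> n j) < e" and "m \<ge> N" for e N m
  proof -
    have "L2_set (\<lambda>j. cmod (\<sigma> m j - l j)) {..<k} \<le> e" for k
    proof (rule tendsto_upperbound)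
      show "(\<lambda>n. L2_set (\<lambda>j. cmod (\<sigma> m j - \<sigma> n j)) {..<k}) \<longlonglongrightarrow> L2_set (\<lambda>j. cmod (\<sigma> m j - l j)) {..<k}"
        unfolding L2_set_def by (intro tendsto_intros l)
      show "\<forall>\<^sub>F n in sequentially. L2_set (\<lambda>j. cmod (\<sigma> m j - \<sigma> n j)) {..<k} \<le> e"
        unfolding eventually_sequentially
      proof (intro exI[of _ N] allI impI)
        fix n assume "N \<le> n"
        then have "l2norm (\<lambda>j. \<sigma> m j - \<sigma> n j) < e" using that by blast
        then show "L2_set (\<lambda>j. cmod (\<sigma> m j - \<sigma> n j)) {..<k} \<le> e"
          using l2_partial[OF l2_diff(1)[OF \<sigma>[of m] \<sigma>[of n]], of "{..<k}"] by simp
      qed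
    qed simp
    from l2_bound[of "\<lambda>j. \<sigma> m j - l j", OF this] show ?thesis by blast
  qed
  show ?thesis
  proof
    from cau[of 1] obtain N where "\<forall>m\<ge>N. \<forall>n\<ge>N. l2norm (\<lambda>j. \<sigma> m j - \<sigma> n j) < 1" by auto
    from tail[OF this, of N] have "(\<lambda>j. \<sigma> N j - l j) \<in> l2" by blast
    from l2_diff(1)[OF \<sigma>[of N] this] show "l \<in> l2" by simp
    show "(\<lambda>n. l2norm (\<lambda>j. \<sigma> n j - l j)) \<longlonglongrightarrow> 0"
    proof (rule LIMSEQ_I)
      fix e :: real assume "0 < e"
      then obtain N where N: "\<forall>m\<ge>N. \<forall>n\<ge>N. l2norm (\<lambda>j. \<sigma> m j - \<sigma> n j) < e/2" using cau[of "e/2"] by auto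
      show "\<exists>no. \<forall>n\<ge>no. norm (l2norm (\<lambda>j. \<sigma> n j - l j) - 0) < e"
        using tail[OF N] \<open>0 < e\<close> by (intro exI[of _ N]) force
    qed
  qed
qed

section \<open>Power series on the unit disc\<close>

text \<open>Angles are counted in full turns: integrals over [0,1] are then means over the circle,
  and the Cantor subset of [0,1] is wrapped around the circle once.\<close>

definition circ :: "real \<Rightarrow> complex"
  where "circ t = cis (2 * pi * t)"

lemma norm_circ [simp]: "cmod (circ t) = 1"
  by (simp add: circ_def)

lemma continuous_on_circ [continuous_intros]: "continuous_on A circ"
  unfolding circ_def by (intro continuous_intros continuous_on_cis)

definition power_series :: "(nat \<Rightarrow> complex) \<Rightarrow> (complex \<Rightarrow> complex) \<Rightarrow> bool"
  where "power_series a F \<longleftrightarrow> (\<forall>z\<in>ball 0 1. (\<lambda>k. a k * z ^ k) sums F z)"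

lemma power_series_exists:
  assumes "F holomorphic_on ball 0 1"
  obtains a where "power_series a F"
proof
  show "power_series (\<lambda>n. (deriv ^^ n) F 0 / fact n) F"
    using holomorphic_power_series[OF assms] by (auto simp: power_series_def)
qed

lemma power_series_summable_norm:
  assumes "power_series a F" and "cmod z < 1"
  shows "summable (\<lambda>k. cmod (a k * z ^ k))"
proof -
  obtain r where r: "cmod z < r" "r < 1" using assms(2) dense by blast
  have r0: "0 \<le> r" using r(1) norm_ge_zero[of z] by linarith
  then have "of_real r \<in> ball (0::complex) 1" using r by auto
  then have "summable (\<lambda>k. a k * of_real r ^ k)"
    using assms(1) sums_summable unfolding power_series_def by blast
  from powser_insidea[OF this, of z] show ?thesis using r r0 by auto
qed

definition conv :: "(nat \<Rightarrow> complex) \<Rightarrow> (nat \<Rightarrow> complex) \<Rightarrow> nat \<Rightarrow> complex"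
  where "conv a b n = (\<Sum>i\<le>n. a i * b (n - i))"

lemma conv_commute: "conv a b = conv b a"
proof
  fix n show "conv a b n = conv b a n"
    unfolding conv_def by (rule sum.reindex_bij_witness[of _ "\<lambda>i. n - i" "\<lambda>i. n - i"]) auto
qed

lemma power_series_mult:
  assumes a: "power_series a F" and b: "power_series b G"
  shows "power_series (conv a b) (\<lambda>z. F z * G z)"
  unfolding power_series_def
proof
  fix z :: complex assume z: "z \<in> ball 0 1"
  then have z1: "cmod z < 1" by simp
  have eq: "(\<Sum>k. a k * z ^ k) = F z" "(\<Sum>k. b k * z ^ k) = G z"
    using a b z unfolding power_series_def by (auto simp: sums_iff)
  have "(\<Sum>i\<le>k. (a i * z ^ i) * (b (k - i) * z ^ (k - i))) = conv a b k * z ^ k" for k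
    unfolding conv_def sum_distrib_right
  proof (rule sum.cong[OF refl])
    fix i assume "i \<in> {..k}"
    then have "z ^ k = z ^ i * z ^ (k - i)" by (simp flip: power_add)
    then show "a i * z ^ i * (b (k - i) * z ^ (k - i)) = a i * b (k - i) * z ^ k" by simp
  qed
  then show "(\<lambda>k. conv a b k * z ^ k) sums (F z * G z)"
    using Cauchy_product_sums[OF power_series_summable_norm[OF a z1] power_series_summable_norm[OF b z1]]
    by (simp add: eq)
qed

lemma power_series_diff:
  "power_series a F \<Longrightarrow> power_series b G \<Longrightarrow> power_series (\<lambda>k. a k - b k) (\<lambda>z. F z - G z)"
  unfolding power_series_def by (auto simp: algebra_simps intro!: sums_diff)

lemma power_series_monom: "power_series (\<lambda>k. if k = n then c else 0) (\<lambda>z. c * z ^ n)"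
  unfolding power_series_def
proof
  fix z :: complex
  have "(\<lambda>k. (if k = n then c else 0) * z ^ k) = (\<lambda>k. if k = n then c * z ^ k else 0)" by auto
  then show "(\<lambda>k. (if k = n then c else 0) * z ^ k) sums (c * z ^ n)"
    using sums_single[of n "\<lambda>k. c * z ^ k"] by simp
qed

section \<open>Parseval's identity, Cauchy's estimate and comparison of coefficient norms\<close>

lemma has_integral_circ_int:
  fixes m :: int
  shows "((\<lambda>t. circ (of_int m * t)) has_integral (if m = 0 then 1 else 0)) {0..1}"
proof (cases "m = 0")
  case True
  then show ?thesis using has_integral_const_real[of "1::complex" 0 1] by (simp add: circ_def)
next
  case False
  define c where "c = 2 * of_real pi * \<i> * of_int m"
  have c: "c \<noteq> 0" using False by (simp add: c_def)
  have "((\<lambda>t. exp (c * of_real t)) has_integral (exp (c * of_real 1) / c - exp (c * of_real 0) / c)) {0..1}"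
  proof (rule fundamental_theorem_of_calculus)
    fix t :: real
    show "((\<lambda>t. exp (c * of_real t) / c) has_vector_derivative exp (c * of_real t)) (at t within {0..1})"
      using c by (auto intro!: derivative_eq_intros has_vector_derivative_real_field)
  qed simp
  moreover have "exp c = 1" unfolding c_def exp_eq_1 by auto
  moreover have "circ (of_int m * t) = exp (c * of_real t)" for t
    by (simp add: circ_def cis_conv_exp c_def mult_ac)
  ultimately show ?thesis using False by simp
qed

lemma parseval_finite:
  fixes a :: "nat \<Rightarrow> complex" and r :: real
  shows "((\<lambda>t. (cmod (\<Sum>k<n. a k * (of_real r * circ t) ^ k))\<^sup>2) has_integral
    (\<Sum>k<n. (cmod (a k))\<^sup>2 * r ^ (2 * k))) {0..1}"
proof -
  define b where "b k = a k * of_real r ^ k" for k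
  have circ_pow: "circ t ^ j * cnj (circ t ^ k) = circ (of_int (int j - int k) * t)" for t j k
  proof -
    have "circ t ^ j * cnj (circ t ^ k) = cis (real j * (2 * pi * t)) * cnj (cis (real k * (2 * pi * t)))"
      by (simp only: circ_def Complex.DeMoivre)
    also have "\<dots> = circ (of_int (int j - int k) * t)"
      by (simp add: circ_def cis_cnj cis_mult algebra_simps)
    finally show ?thesis .
  qed
  have eq: "complex_of_real ((cmod (\<Sum>k<n. a k * (of_real r * circ t) ^ k))\<^sup>2) =
      (\<Sum>j<n. \<Sum>k<n. b j * cnj (b k) * circ (of_int (int j - int k) * t))" for t
  proof -
    have P: "(\<Sum>k<n. a k * (of_real r * circ t) ^ k) = (\<Sum>k<n. b k * circ t ^ k)"
      by (simp add: b_def power_mult_distrib mult_ac)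
    have "complex_of_real ((cmod (\<Sum>k<n. b k * circ t ^ k))\<^sup>2) =
        (\<Sum>j<n. \<Sum>k<n. (b j * circ t ^ j) * cnj (b k * circ t ^ k))"
      unfolding complex_norm_square cnj_sum sum_product ..
    also have "\<dots> = (\<Sum>j<n. \<Sum>k<n. b j * cnj (b k) * (circ t ^ j * cnj (circ t ^ k)))"
      by (simp add: mult_ac)
    finally show ?thesis unfolding P circ_pow .
  qed
  have "((\<lambda>t. \<Sum>j<n. \<Sum>k<n. b j * cnj (b k) * circ (of_int (int j - int k) * t)) has_integral
     (\<Sum>j<n. \<Sum>k<n. b j * cnj (b k) * (if int j - int k = 0 then 1 else 0))) {0..1}"
    by (intro has_integral_sum has_integral_mult_right has_integral_circ_int) auto
  also have "(\<Sum>j<n. \<Sum>k<n. b j * cnj (b k) * (if int j - int k = 0 then 1 else 0)) =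
      (\<Sum>j<n. b j * cnj (b j))"
    by (simp add: if_distrib[of "\<lambda>x. _ * x"] cong: if_cong)
  also have "\<dots> = of_real (\<Sum>k<n. (cmod (a k))\<^sup>2 * r ^ (2 * k))"
  proof -
    have "b j * cnj (b j) = of_real ((cmod (a j))\<^sup>2 * r ^ (2 * j))" for j
      using complex_norm_square[of "a j"] by (simp add: b_def power_mult power2_eq_square power_mult_distrib mult_ac)
    then show ?thesis by simp
  qed
  finally have "((\<lambda>t. complex_of_real ((cmod (\<Sum>k<n. a k * (of_real r * circ t) ^ k))\<^sup>2)) has_integral
      of_real (\<Sum>k<n. (cmod (a k))\<^sup>2 * r ^ (2 * k))) {0..1}"
    by (simp only: eq)
  from has_integral_Re[OF this] show ?thesis by simp
qed

text \<open>Polynomials pass to the limit by dominated convergence: on a circle of radius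
  \<open>r < 1\<close> all partial sums are bounded by the absolutely convergent series
  \<open>B\<close>.\<close>

lemma parseval:
  assumes F: "power_series a F" and r: "0 \<le> r" "r < 1"
  shows "summable (\<lambda>k. (cmod (a k))\<^sup>2 * r ^ (2 * k))"
    and "((\<lambda>t. (cmod (F (of_real r * circ t)))\<^sup>2) has_integral
      (\<Sum>k. (cmod (a k))\<^sup>2 * r ^ (2 * k))) {0..1}"
proof -
  define B where "B = (\<Sum>k. cmod (a k * of_real r ^ k))"
  have sr: "summable (\<lambda>k. cmod (a k * of_real r ^ k))"
    using power_series_summable_norm[OF F, of "of_real r"] r by simp
  have bnd: "norm ((cmod (\<Sum>k<n. a k * (of_real r * circ t) ^ k))\<^sup>2) \<le> B\<^sup>2" for n t
  proof -
    have "cmod (\<Sum>k<n. a k * (of_real r * circ t) ^ k) \<le> (\<Sum>k<n. cmod (a k * of_real r ^ k))"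
      by (rule order_trans[OF norm_sum]) (simp add: norm_mult norm_power)
    also have "\<dots> \<le> B" unfolding B_def by (intro sum_le_suminf sr) auto
    finally show ?thesis by (simp add: power_mono)
  qed
  have "(\<Sum>k<n. (cmod (a k))\<^sup>2 * r ^ (2 * k)) \<le> B\<^sup>2" for n
    using has_integral_le[OF parseval_finite[of a r n] has_integral_const_real[of "B\<^sup>2" 0 1]] bnd by force
  then show s: "summable (\<lambda>k. (cmod (a k))\<^sup>2 * r ^ (2 * k))"
    using r by (intro summableI_nonneg_bounded[where x = "B\<^sup>2"]) auto
  show "((\<lambda>t. (cmod (F (of_real r * circ t)))\<^sup>2) has_integral
      (\<Sum>k. (cmod (a k))\<^sup>2 * r ^ (2 * k))) {0..1}"
  proof (rule has_integral_dominated_convergence[OF parseval_finite])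
    show "(\<lambda>t::real. B\<^sup>2) integrable_on {0..1}" by (intro integrable_continuous_interval continuous_intros)
    show "\<forall>t\<in>{0..1}. norm ((cmod (\<Sum>k<n. a k * (of_real r * circ t) ^ k))\<^sup>2) \<le> B\<^sup>2" for n
      using bnd by blast
    show "\<forall>t\<in>{0..1}. (\<lambda>n. (cmod (\<Sum>k<n. a k * (of_real r * circ t) ^ k))\<^sup>2) \<longlonglongrightarrow>
        (cmod (F (of_real r * circ t)))\<^sup>2"
    proof
      fix t :: real
      have "of_real r * circ t \<in> ball 0 1" using r by (simp add: norm_mult)
      with F have "(\<lambda>k. a k * (of_real r * circ t) ^ k) sums F (of_real r * circ t)"
        unfolding power_series_def by blast
      then show "(\<lambda>n. (cmod (\<Sum>k<n. a k * (of_real r * circ t) ^ k))\<^sup>2) \<longlonglongrightarrow>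
          (cmod (F (of_real r * circ t)))\<^sup>2"
        unfolding sums_def by (intro tendsto_intros)
    qed
    show "(\<lambda>n. \<Sum>k<n. (cmod (a k))\<^sup>2 * r ^ (2 * k)) \<longlonglongrightarrow> (\<Sum>k. (cmod (a k))\<^sup>2 * r ^ (2 * k))"
      by (rule summable_LIMSEQ[OF s])
  qed
qed

text \<open>Cauchy's estimate without contour integrals: a single term of the Parseval sum is at
  most the mean of \<open>B\<^sup>2\<close> over the circle.\<close>

lemma power_series_coeff_bound:
  assumes F: "power_series a F" and r: "0 \<le> r" "r < 1"
    and B: "\<And>z. cmod z = r \<Longrightarrow> cmod (F z) \<le> B"
  shows "cmod (a k) * r ^ k \<le> B"
proof -
  have B0: "0 \<le> B" using order_trans[OF norm_ge_zero B[of "of_real r"]] r by simp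
  have "(cmod (a k) * r ^ k)\<^sup>2 \<le> (\<Sum>k. (cmod (a k))\<^sup>2 * r ^ (2 * k))"
    using sum_le_suminf[OF parseval(1)[OF F r], of "{k}"] r
    by (simp add: power_mult_distrib power_mult power2_eq_square mult_ac)
  also have "\<dots> \<le> B\<^sup>2"
  proof -
    have "(\<Sum>k. (cmod (a k))\<^sup>2 * r ^ (2 * k)) \<le> measure lborel {0..1::real} *\<^sub>R B\<^sup>2"
    proof (rule has_integral_le[OF parseval(2)[OF F r]])
      show "((\<lambda>t::real. B\<^sup>2) has_integral measure lborel {0..1::real} *\<^sub>R B\<^sup>2) {0..1}"
        using has_integral_const[of "B\<^sup>2" 0 "1::real"] by simp
    qed (use B r in \<open>auto intro!: power_mono simp: norm_mult\<close>)
    then show ?thesis by simp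
  qed
  finally show ?thesis using B0 power2_le_imp_le by blast
qed

text \<open>The difference of the sequences represents the zero function, so Cauchy's estimate
  applies to it with bound 0.\<close>

lemma power_series_unique:
  assumes "power_series a F" and "power_series b F"
  shows "a = b"
proof
  fix k
  have "cmod (a k - b k) * (1/2) ^ k \<le> 0"
    by (rule power_series_coeff_bound[OF power_series_diff[OF assms]]) auto
  moreover have "(0::real) < (1/2) ^ k" by simp
  ultimately have "cmod (a k - b k) \<le> 0" by (meson mult_le_0_iff not_le)
  then show "a k = b k" by simp
qed

lemma parseval_le_l2norm:
  assumes F: "power_series a F" and r: "0 \<le> r" "r < 1" and a: "a \<in> l2"
  shows "(\<Sum>k. (cmod (a k))\<^sup>2 * r ^ (2 * k)) \<le> (l2norm a)\<^sup>2"
  unfolding l2norm_sq[OF a]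
proof (rule suminf_le[OF _ parseval(1)[OF F r]])
  show "summable (\<lambda>k. (cmod (a k))\<^sup>2)" using a by (simp add: l2_def)
  show "(cmod (a k))\<^sup>2 * r ^ (2 * k) \<le> (cmod (a k))\<^sup>2" for k
    using r by (intro mult_right_le_one_le power_le_one) auto
qed

text \<open>The substitute for comparing boundary values: the pointwise inequality is integrated
  over circles of radius r < 1 by Parseval, and r tends to 1.\<close>

lemma l2_compare:
  assumes F: "power_series a F" and G: "power_series b G" and b: "b \<in> l2" and B: "0 \<le> B"
    and le: "\<And>z. cmod z < 1 \<Longrightarrow> cmod (F z) \<le> B * cmod (G z)"
  shows "a \<in> l2" and "l2norm a \<le> B * l2norm b"
proof -
  have fin: "(\<Sum>k<n. (cmod (a k))\<^sup>2 * r ^ (2 * k)) \<le> (B * l2norm b)\<^sup>2" if r: "0 \<le> r" "r < 1" for n r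
  proof -
    have "(\<Sum>k<n. (cmod (a k))\<^sup>2 * r ^ (2 * k)) \<le> (\<Sum>k. (cmod (a k))\<^sup>2 * r ^ (2 * k))"
      using r by (intro sum_le_suminf parseval(1)[OF F r]) auto
    also have "\<dots> \<le> B\<^sup>2 * (\<Sum>k. (cmod (b k))\<^sup>2 * r ^ (2 * k))"
    proof (rule has_integral_le[OF parseval(2)[OF F r] has_integral_mult_right[OF parseval(2)[OF G r]]])
      fix t :: real
      have "cmod (F (of_real r * circ t)) \<le> B * cmod (G (of_real r * circ t))"
        using r by (intro le) (simp add: norm_mult)
      from power_mono[OF this, of 2]
      show "(cmod (F (of_real r * circ t)))\<^sup>2 \<le> B\<^sup>2 * (cmod (G (of_real r * circ t)))\<^sup>2"
        by (simp add: power_mult_distrib)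
    qed
    also have "\<dots> \<le> B\<^sup>2 * (l2norm b)\<^sup>2"
      by (intro mult_left_mono parseval_le_l2norm[OF G r b]) simp
    finally show ?thesis by (simp add: power_mult_distrib)
  qed
  have "L2_set (\<lambda>j. cmod (a j)) {..<n} \<le> B * l2norm b" for n
  proof -
    \<comment> \<open>Truncating before \<open>r\<close> tends to 1 leaves a polynomial in
      \<open>r\<close>, so continuity is enough.\<close>
    have "(\<Sum>k<n. (cmod (a k))\<^sup>2 * 1 ^ (2 * k)) \<le> (B * l2norm b)\<^sup>2"
    proof (rule tendsto_upperbound)
      show "((\<lambda>r. \<Sum>k<n. (cmod (a k))\<^sup>2 * r ^ (2 * k)) \<longlongrightarrow> (\<Sum>k<n. (cmod (a k))\<^sup>2 * 1 ^ (2 * k))) (at_left (1::real))"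
        by (intro tendsto_intros)
      show "\<forall>\<^sub>F r in at_left 1. (\<Sum>k<n. (cmod (a k))\<^sup>2 * r ^ (2 * k)) \<le> (B * l2norm b)\<^sup>2"
        using eventually_at_left_real[of 0 "1::real"] by (auto elim!: eventually_mono intro: fin)
    qed simp
    then show ?thesis unfolding L2_set_def using B b by (intro real_le_lsqrt) auto
  qed
  from l2_bound[of a, OF this] show "a \<in> l2" and "l2norm a \<le> B * l2norm b" .
qed

section \<open>Bounded multipliers and their transposes\<close>

lemma l2_power_series:
  assumes "g \<in> l2"
  obtains G where "power_series g G"
proof
  show "power_series g (\<lambda>z. \<Sum>k. g k * z ^ k)"
    unfolding power_series_def
  proof
    fix z :: complex assume z: "z \<in> ball 0 1"
    have "summable (\<lambda>k. g k * z ^ k)"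
    proof (rule summable_comparison_test')
      show "summable (\<lambda>k. l2norm g * cmod z ^ k)" using z by (intro summable_mult summable_geometric) auto
      show "cmod (g k * z ^ k) \<le> l2norm g * cmod z ^ k" for k
        unfolding norm_mult norm_power by (intro mult_right_mono l2_coord assms) auto
    qed
    then show "(\<lambda>k. g k * z ^ k) sums (\<Sum>k. g k * z ^ k)" by (rule summable_sums)
  qed
qed

lemma l2norm_delta [simp]: "l2norm (\<lambda>k. if k = n then c else 0) = cmod c"
proof -
  have "(\<lambda>k. (cmod (if k = n then c else 0))\<^sup>2) = (\<lambda>k. if k = n then (cmod c)\<^sup>2 else 0)" by auto
  then show ?thesis unfolding l2norm_def using sums_single[of n "\<lambda>k. (cmod c)\<^sup>2"]
    by (simp add: sums_iff)
qed

lemma l2_delta [simp]: "(\<lambda>k. if k = n then c else 0) \<in> l2"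
  by (rule l2_finite_support[of "Suc n"]) auto

text \<open>Coefficients of a function in H^\<infinity>, with a bound for its supremum on the
  disc.\<close>

definition multiplier :: "(nat \<Rightarrow> complex) \<Rightarrow> real \<Rightarrow> bool"
  where "multiplier u B \<longleftrightarrow> 0 \<le> B \<and> (\<exists>U. power_series u U \<and> (\<forall>z. cmod z < 1 \<longrightarrow> cmod (U z) \<le> B))"

lemma multiplier_nonneg: "multiplier u B \<Longrightarrow> 0 \<le> B"
  by (simp add: multiplier_def)

text \<open>Comparison with the constant function 1, whose coefficient sequence has norm 1.\<close>

lemma multiplier_l2:
  assumes "multiplier u B"
  shows "u \<in> l2" and "l2norm u \<le> B"
proof -
  obtain U where U: "power_series u U" "\<And>z. cmod z < 1 \<Longrightarrow> cmod (U z) \<le> B" "0 \<le> B"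
    using assms by (auto simp: multiplier_def)
  show "u \<in> l2" "l2norm u \<le> B"
    using l2_compare[OF U(1) power_series_monom[of 0 1] l2_delta U(3)] U(2) by auto
qed

lemma multiplier_conv:
  assumes u: "multiplier u B" and g: "g \<in> l2"
  shows "conv g u \<in> l2" and "l2norm (conv g u) \<le> B * l2norm g"
proof -
  obtain U where U: "power_series u U" "\<And>z. cmod z < 1 \<Longrightarrow> cmod (U z) \<le> B" "0 \<le> B"
    using u by (auto simp: multiplier_def)
  obtain G where G: "power_series g G" using l2_power_series[OF g] .
  have le: "cmod (G z * U z) \<le> B * cmod (G z)" if "cmod z < 1" for z
    unfolding norm_mult using mult_left_mono[OF U(2)[OF that], of "cmod (G z)"] by (simp add: mult.commute)
  show "conv g u \<in> l2" "l2norm (conv g u) \<le> B * l2norm g"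
    using l2_compare[OF power_series_mult[OF G U(1)] G g U(3) le] by auto
qed

text \<open>The transpose of multiplication by the function with coefficients \<open>u\<close>, that
  is, a coanalytic Toeplitz operator up to conjugation of the coefficients. For the function z it is
  the backward shift.\<close>

definition toep :: "(nat \<Rightarrow> complex) \<Rightarrow> (nat \<Rightarrow> complex) \<Rightarrow> nat \<Rightarrow> complex"
  where "toep u f j = (\<Sum>k. u k * f (j + k))"

lemma toep_shift: "toep u (\<lambda>j. f (j + k)) j = toep u f (j + k)"
  by (simp add: toep_def add_ac)

lemma toep_summable: "u \<in> l2 \<Longrightarrow> f \<in> l2 \<Longrightarrow> summable (\<lambda>k. u k * f (j + k))"
  using l2_mult(2)[OF _ l2_shift(1)[of f j]] by (simp add: add.commute)

lemma toep_bound: "u \<in> l2 \<Longrightarrow> f \<in> l2 \<Longrightarrow> cmod (toep u f j) \<le> l2norm u * l2norm f"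
  unfolding toep_def
  using l2_mult(3)[OF _ l2_shift(1)[of f j], of u] mult_left_mono[OF l2_shift(2)[of f j], of "l2norm u"]
  by (simp add: add.commute)

lemma toep_diff:
  assumes "u \<in> l2" "f \<in> l2" "g \<in> l2"
  shows "toep u (\<lambda>j. f j - g j) = (\<lambda>j. toep u f j - toep u g j)"
  unfolding toep_def using assms
  by (auto simp: right_diff_distrib suminf_diff toep_summable)

lemma toep_add:
  assumes "u \<in> l2" "f \<in> l2" "g \<in> l2"
  shows "toep u (\<lambda>j. f j + g j) = (\<lambda>j. toep u f j + toep u g j)"
  unfolding toep_def using assms
  by (auto simp: distrib_left suminf_add toep_summable)

lemma toep_scale:
  assumes "u \<in> l2" "f \<in> l2"
  shows "toep u (\<lambda>j. c * f j) = (\<lambda>j. c * toep u f j)"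
  unfolding toep_def using assms
  by (auto simp: mult.left_commute[of _ c] suminf_mult toep_summable)

text \<open>For finitely supported \<open>g\<close> the exchange of summations concerns only
  finitely many convergent series.\<close>

lemma toep_pairing_finite:
  assumes u: "u \<in> l2" and f: "f \<in> l2" and g: "\<And>j. j \<ge> N \<Longrightarrow> g j = 0"
  shows "(\<Sum>j<N. g j * toep u f j) = (\<Sum>m. f m * conv g u m)"
proof -
  \<comment> \<open>\<open>v j\<close> is \<open>u\<close> delayed by \<open>j\<close> places, the
    coefficients of z^j times the function of \<open>u\<close>.\<close>
  define v where "v j m = (if m < j then 0 else u (m - j))" for j m
  have cv: "conv g u m = (\<Sum>j<N. g j * v j m)" for m
  proof -
    have "conv g u m = (\<Sum>j\<le>m. g j * v j m)" unfolding conv_def v_def by (auto intro!: sum.cong)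
    also have "\<dots> = (\<Sum>j\<in>{..m} \<union> {..<N}. g j * v j m)"
      by (rule sum.mono_neutral_left) (auto simp: v_def)
    also have "\<dots> = (\<Sum>j<N. g j * v j m)"
      by (rule sum.mono_neutral_right) (auto simp: g not_less)
    finally show ?thesis .
  qed
  have sv: "(\<lambda>m. f m * v j m) sums toep u f j" for j
  proof -
    have "(\<lambda>k. u k * f (j + k)) sums toep u f j"
      unfolding toep_def by (rule summable_sums[OF toep_summable[OF u f]])
    then have "(\<lambda>k. f (k + j) * v j (k + j)) sums toep u f j" by (simp add: v_def add.commute mult.commute)
    then have "(\<lambda>m. f m * v j m) sums (toep u f j + (\<Sum>i<j. f i * v j i))"
      using sums_iff_shift[of "\<lambda>m. f m * v j m" j] by simp
    then show ?thesis by (simp add: v_def)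
  qed
  have "(\<lambda>m. \<Sum>j<N. g j * (f m * v j m)) sums (\<Sum>j<N. g j * toep u f j)"
    by (intro sums_sum sums_mult sv)
  moreover have "(\<Sum>j<N. g j * (f m * v j m)) = f m * conv g u m" for m
    by (simp add: cv sum_distrib_left mult.left_commute)
  ultimately show ?thesis by (simp add: sums_iff)
qed

text \<open>Duality: the first \<open>n\<close> coordinates of \<open>toep u f\<close> are paired
  with their own conjugates, the operator is moved to the other side as a convolution, and one
  factor of the norm cancels.\<close>

lemma toep_l2:
  assumes u: "multiplier u B" and f: "f \<in> l2"
  shows "toep u f \<in> l2" and "l2norm (toep u f) \<le> B * l2norm f"
proof -
  have "L2_set (\<lambda>j. cmod (toep u f j)) {..<n} \<le> B * l2norm f" for n
  proof -
    let ?L = "L2_set (\<lambda>j. cmod (toep u f j)) {..<n}"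
    define g where "g j = (if j < n then cnj (toep u f j) else 0)" for j
    have gl: "g \<in> l2" by (rule l2_finite_support[of n]) (simp add: g_def)
    have "(\<lambda>j. (cmod (g j))\<^sup>2) sums (\<Sum>j<n. (cmod (g j))\<^sup>2)" by (rule sums_finite) (auto simp: g_def)
    then have gn: "l2norm g = ?L" by (simp add: l2norm_def sums_iff L2_set_def g_def)
    have "of_real (?L\<^sup>2) = (\<Sum>j<n. g j * toep u f j)"
    proof -
      have "g j * toep u f j = of_real ((cmod (toep u f j))\<^sup>2)" if "j < n" for j
        using that complex_norm_square[of "toep u f j"] by (simp add: g_def mult.commute)
      then show ?thesis by (simp add: L2_set_def sum_nonneg)
    qed
    also have "\<dots> = (\<Sum>m. f m * conv g u m)"
      by (rule toep_pairing_finite[OF multiplier_l2(1)[OF u] f]) (simp add: g_def)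
    finally have "?L\<^sup>2 = cmod (\<Sum>m. f m * conv g u m)" by (metis norm_of_real abs_power2)
    also have "\<dots> \<le> l2norm f * l2norm (conv g u)" by (rule l2_mult(3)[OF f multiplier_conv(1)[OF u gl]])
    also have "\<dots> \<le> l2norm f * (B * ?L)"
      using multiplier_conv(2)[OF u gl] f by (intro mult_left_mono) (auto simp: gn)
    finally have "?L * ?L \<le> (B * l2norm f) * ?L" by (simp add: power2_eq_square mult_ac)
    moreover have "0 \<le> B * l2norm f" using f multiplier_nonneg[OF u] by simp
    ultimately show ?thesis by (cases "?L = 0") (auto simp: mult_le_cancel_right less_le L2_set_nonneg)
  qed
  from l2_bound[of "toep u f", OF this] show "toep u f \<in> l2" "l2norm (toep u f) \<le> B * l2norm f" .
qed

text \<open>Cutting \<open>a\<close> at \<open>N\<close> leaves as error the pairing of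
  \<open>f\<close> with the convolution of the tail, which the multiplier bound makes small.\<close>

lemma toep_pairing:
  assumes u: "multiplier u B" and f: "f \<in> l2" and a: "a \<in> l2"
  shows "(\<Sum>j. a j * toep u f j) = (\<Sum>m. f m * conv a u m)"
proof -
  define g where "g N j = (if j < N then a j else 0)" for N j
  define h where "h N j = (if j < N then 0 else a j)" for N j
  have g: "g N \<in> l2" for N by (rule l2_finite_support[of N]) (simp add: g_def)
  have h: "h N \<in> l2" for N
  proof -
    have "h N = (\<lambda>j. a j - g N j)" by (auto simp: g_def h_def)
    then show ?thesis using l2_diff(1)[OF a g[of N]] by simp
  qed
  have split: "conv a u m - conv (g N) u m = conv (h N) u m" for N m
    by (simp add: conv_def g_def h_def if_distrib[of "\<lambda>x. x * _"] flip: sum_subtractf cong: if_cong)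
      (auto intro!: sum.cong)
  have fin: "(\<Sum>j<N. a j * toep u f j) = (\<Sum>m. f m * conv (g N) u m)" for N
    using toep_pairing_finite[OF multiplier_l2(1)[OF u] f, of N "g N"] by (simp add: g_def)
  have "cmod ((\<Sum>m. f m * conv a u m) - (\<Sum>j<N. a j * toep u f j)) \<le> l2norm f * (B * l2norm (h N))" for N
  proof -
    have "(\<Sum>m. f m * conv a u m) - (\<Sum>j<N. a j * toep u f j) = (\<Sum>m. f m * conv (h N) u m)"
      unfolding fin
      by (subst suminf_diff) (auto simp: split multiplier_conv(1)[OF u] a g l2_mult(2)[OF f] simp flip: right_diff_distrib)
    then have "cmod ((\<Sum>m. f m * conv a u m) - (\<Sum>j<N. a j * toep u f j)) \<le> l2norm f * l2norm (conv (h N) u)"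
      using l2_mult(3)[OF f multiplier_conv(1)[OF u h]] by simp
    also have "\<dots> \<le> l2norm f * (B * l2norm (h N))"
      using f by (intro mult_left_mono multiplier_conv(2)[OF u h]) auto
    finally show ?thesis .
  qed
  moreover have "(\<lambda>N. l2norm f * (B * l2norm (h N))) \<longlonglongrightarrow> 0"
  proof -
    have "(\<lambda>N. l2norm (h N)) \<longlonglongrightarrow> 0" unfolding h_def[abs_def] by (rule l2_truncate[OF a])
    then show ?thesis by (auto intro!: tendsto_eq_intros)
  qed
  ultimately have "(\<lambda>N. (\<Sum>m. f m * conv a u m) - (\<Sum>j<N. a j * toep u f j)) \<longlonglongrightarrow> 0"
    by (rule Lim_null_comparison[OF always_eventually[OF allI]])
  from tendsto_diff[OF tendsto_const[of "\<Sum>m. f m * conv a u m"] this]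
  have "(\<lambda>j. a j * toep u f j) sums (\<Sum>m. f m * conv a u m)" by (simp add: sums_def)
  then show ?thesis by (simp add: sums_iff)
qed

text \<open>Both compositions pair a shift of \<open>f\<close> with the convolution of the two
  coefficient sequences, and convolution is commutative.\<close>

lemma toep_commute:
  assumes a: "multiplier a A" and u: "multiplier u B" and f: "f \<in> l2"
  shows "toep a (toep u f) = toep u (toep a f)"
proof
  fix k
  have eq: "toep a (toep u f) k = (\<Sum>m. f (m + k) * conv a u m)" if "multiplier a A" "multiplier u B" for a u A B
  proof -
    have "toep a (toep u f) k = (\<Sum>j. a j * toep u (\<lambda>j. f (j + k)) j)"
      by (simp add: toep_def add_ac)
    also have "\<dots> = (\<Sum>m. f (m + k) * conv a u m)"
      by (rule toep_pairing[OF that(2) l2_shift(1)[OF f] multiplier_l2(1)[OF that(1)]])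
    finally show ?thesis .
  qed
  show "toep a (toep u f) k = toep u (toep a f) k"
    unfolding eq[OF a u] eq[OF u a] by (simp add: conv_commute)
qed

lemma l2norm_add_sq:
  assumes f: "f \<in> l2" and g: "g \<in> l2"
  shows "(l2norm (\<lambda>j. f j + g j))\<^sup>2 = (l2norm f)\<^sup>2 + (l2norm g)\<^sup>2 + 2 * Re (\<Sum>j. f j * cnj (g j))"
proof -
  have s: "(\<lambda>j. f j * cnj (g j)) sums (\<Sum>j. f j * cnj (g j))"
    by (rule summable_sums[OF l2_mult(2)[OF f l2_cnj(1)[OF g]]])
  have "(\<lambda>j. (cmod (f j))\<^sup>2 + (cmod (g j))\<^sup>2 + 2 * Re (f j * cnj (g j))) sums
      ((l2norm f)\<^sup>2 + (l2norm g)\<^sup>2 + 2 * Re (\<Sum>j. f j * cnj (g j)))"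
    unfolding l2norm_sq[OF f] l2norm_sq[OF g]
    using f g by (intro sums_add sums_mult sums_Re s summable_sums) (auto simp: l2_def)
  moreover have "(cmod (x + y))\<^sup>2 = (cmod x)\<^sup>2 + (cmod y)\<^sup>2 + 2 * Re (x * cnj y)" for x y :: complex
    unfolding cmod_power2 by (simp add: power2_eq_square algebra_simps)
  ultimately show ?thesis unfolding l2norm_sq[OF l2_add(1)[OF f g]] by (simp add: sums_iff)
qed

text \<open>Multiplication by a bounded function of supremum at most 1 is contractive; if the function has
  norm 1, applying this to \<open>1 + p z\<^sup>k\<close> with \<open>p\<close> the inner product below shows \<open>p = 0\<close>.\<close>

lemma inner_orthogonal_shift:
  assumes s: "multiplier s 1" and n: "l2norm s = 1" and k: "k > 0"
  shows "(\<Sum>j. s (j + k) * cnj (s j)) = 0"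
proof -
  note sl = multiplier_l2(1)[OF s]
  define p where "p = (\<Sum>j. s (j + k) * cnj (s j))"
  define g where "g j = (if j = 0 then 1 else if j = k then p else 0)" for j
  define R where "R m = (if m < k then 0 else p * s (m - k))" for m
  have g: "g \<in> l2" by (rule l2_finite_support[of "Suc k"]) (auto simp: g_def)
  have gs: "conv g s = (\<lambda>m. s m + R m)"
  proof
    fix m
    have "conv g s m = (\<Sum>i\<in>{..m}. (if i = 0 then s m else 0) + (if i = k then p * s (m - k) else 0))"
      unfolding conv_def using k by (intro sum.cong) (auto simp: g_def)
    then show "conv g s m = s m + R m" by (auto simp: sum.distrib R_def)
  qed
  have Rl: "R \<in> l2"
    using l2_diff(1)[OF multiplier_conv(1)[OF s g] sl] by (simp add: gs)
  have "(\<lambda>j. R (j + k)) = (\<lambda>j. p * s j)" by (simp add: R_def)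
  then have Rn: "cmod p \<le> l2norm R" using l2_shift(2)[OF Rl, of k] l2_scale(2)[OF sl, of p] n by simp
  have gn: "(l2norm g)\<^sup>2 = 1 + (cmod p)\<^sup>2"
  proof -
    have "(\<lambda>j. (cmod (g j))\<^sup>2) sums (\<Sum>j\<in>{0,k}. (cmod (g j))\<^sup>2)" by (rule sums_finite) (auto simp: g_def)
    then show ?thesis using k by (simp add: l2norm_sq[OF g] sums_iff g_def)
  qed
  have in_prod: "(\<Sum>j. s j * cnj (R j)) = cnj p * p"
  proof -
    have "summable (\<lambda>j. s j * cnj (R j))" by (rule l2_mult(2)[OF sl l2_cnj(1)[OF Rl]])
    from suminf_split_initial_segment[OF this, of k]
    have "(\<Sum>j. s j * cnj (R j)) = (\<Sum>j. s (j + k) * cnj (R (j + k)))" by (simp add: R_def)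
    also have "\<dots> = (\<Sum>j. cnj p * (s (j + k) * cnj (s j)))" by (simp add: R_def mult.left_commute)
    also have "\<dots> = cnj p * p"
      unfolding p_def by (rule suminf_mult) (rule l2_mult(2)[OF l2_shift(1)[OF sl] l2_cnj(1)[OF sl]])
    finally show ?thesis .
  qed
  have "2 * Re (\<Sum>j. s j * cnj (R j)) = 2 * (cmod p)\<^sup>2"
    unfolding in_prod cmod_power2 by (simp add: power2_eq_square)
  then have "1 + (l2norm R)\<^sup>2 + 2 * (cmod p)\<^sup>2 = (l2norm (conv g s))\<^sup>2"
    unfolding gs l2norm_add_sq[OF sl Rl] n by simp
  also have "\<dots> \<le> (1 * l2norm g)\<^sup>2"
    using multiplier_conv[OF s g] by (intro power_mono) auto
  finally have "(l2norm R)\<^sup>2 + (cmod p)\<^sup>2 \<le> 0" by (simp add: gn)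
  then have "(cmod p)\<^sup>2 \<le> 0" using zero_le_power2[of "l2norm R"] by linarith
  then show ?thesis by (simp add: p_def)
qed

section \<open>The backward shift on the orthogonal complement of an invariant subspace\<close>

definition l2_scale_op :: "complex \<Rightarrow> (nat \<Rightarrow> complex) \<Rightarrow> nat \<Rightarrow> complex"
  where "l2_scale_op c f = (\<lambda>j. c * f j)"

definition l2_ip :: "(nat \<Rightarrow> complex) \<Rightarrow> (nat \<Rightarrow> complex) \<Rightarrow> complex"
  where "l2_ip f g = (\<Sum>j. f j * cnj (g j))"

definition bshift :: "(nat \<Rightarrow> complex) \<Rightarrow> nat \<Rightarrow> complex"
  where "bshift f = (\<lambda>j. f (Suc j))"

lemma bshift_apply: "bshift f j = f (Suc j)"
  by (simp add: bshift_def)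

text \<open>The orthogonal complement of \<open>S H\<^sup>2\<close>, with conjugated coefficients, so that no conjugates of the
  coefficients \<open>s\<close> of \<open>S\<close> are needed.\<close>

definition model_space :: "(nat \<Rightarrow> complex) \<Rightarrow> (nat \<Rightarrow> complex) set"
  where "model_space s = {f \<in> l2. \<forall>k. toep s f k = 0}"

lemma l2_ip_self: "f \<in> l2 \<Longrightarrow> l2_ip f f = of_real ((l2norm f)\<^sup>2)"
proof -
  assume f: "f \<in> l2"
  then have "(\<lambda>j. (cmod (f j))\<^sup>2) sums ((l2norm f)\<^sup>2)"
    unfolding l2norm_sq[OF f] by (intro summable_sums) (simp add: l2_def)
  then have "(\<lambda>j. complex_of_real ((cmod (f j))\<^sup>2)) sums of_real ((l2norm f)\<^sup>2)"
    by (simp only: sums_of_real_iff)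
  then show ?thesis unfolding l2_ip_def complex_norm_square by (simp add: sums_iff)
qed

text \<open>Inner functions without boundary values: a function of modulus at most 1 on the disc is
  inner exactly when its coefficients have norm 1. The sequence \<open>c\<close> expands the
  reciprocal, so it inverts convolution with \<open>s\<close>.\<close>

locale inner_model =
  fixes s c :: "nat \<Rightarrow> complex" and S C :: "complex \<Rightarrow> complex"
  assumes s: "power_series s S" and S_le_1: "\<And>z. cmod z < 1 \<Longrightarrow> cmod (S z) \<le> 1"
    and s_norm: "l2norm s = 1"
    and c: "power_series c C" and SC: "\<And>z. cmod z < 1 \<Longrightarrow> C z * S z = 1"
begin

lemma s_multiplier: "multiplier s 1"
  using s S_le_1 by (auto simp: multiplier_def)

lemmas s_l2 = multiplier_l2(1)[OF s_multiplier]

abbreviation V where "V \<equiv> model_space s"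

lemma V_l2: "f \<in> V \<Longrightarrow> f \<in> l2"
  by (simp add: model_space_def)

lemma V_toep: "f \<in> V \<Longrightarrow> toep s f k = 0"
  by (simp add: model_space_def)

text \<open>Commuting operators preserve each other's kernels, and \<open>V\<close> is the kernel of
  \<open>toep s\<close>.\<close>

lemma toep_V:
  assumes "multiplier u B" and "f \<in> V"
  shows "toep u f \<in> V"
proof -
  have "toep s f = (\<lambda>_. 0)" using V_toep[OF assms(2)] by auto
  then show ?thesis
    using toep_l2(1)[OF assms(1) V_l2[OF assms(2)]] toep_commute[OF s_multiplier assms(1) V_l2[OF assms(2)]]
    by (simp add: model_space_def) (simp add: toep_def)
qed

sublocale complex_hilbert_space l2_scale_op "model_space s" l2_ip
proof -
  have vs: "vector_space l2_scale_op"
    by unfold_locales (auto simp: l2_scale_op_def fun_eq_iff algebra_simps)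
  interpret vector_space l2_scale_op by (rule vs)
  have sub: "subspace V"
    unfolding subspace_def
  proof (intro conjI ballI allI)
    show "0 \<in> V" by (auto simp: model_space_def toep_def l2_def)
  next
    fix x y assume "x \<in> V" "y \<in> V"
    then show "x + y \<in> V"
      by (auto simp: model_space_def plus_fun_def l2_add toep_add s_l2)
  next
    fix a x assume "x \<in> V"
    then show "l2_scale_op a x \<in> V"
      by (auto simp: model_space_def l2_scale_op_def l2_scale toep_scale s_l2)
  qed
  have ips: "summable (\<lambda>j. f j * cnj (g j))" if "f \<in> V" "g \<in> V" for f g
    by (rule l2_mult(2)[OF V_l2[OF that(1)] l2_cnj(1)[OF V_l2[OF that(2)]]])
  have inner: "complex_inner_space l2_scale_op V l2_ip"
  proof
    show "subspace V" by (rule sub)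
  next
    fix x y z assume "x \<in> V" "y \<in> V" "z \<in> V"
    then show "l2_ip (x + y) z = l2_ip x z + l2_ip y z"
      by (simp add: l2_ip_def distrib_right suminf_add[symmetric] ips)
  next
    fix x y a assume "x \<in> V" "y \<in> V"
    then show "l2_ip (l2_scale_op a x) y = a * l2_ip x y"
      by (simp add: l2_ip_def l2_scale_op_def mult.assoc suminf_mult ips)
  next
    fix x y assume "x \<in> V" "y \<in> V"
    from bounded_linear.suminf[OF bounded_linear_cnj ips[OF this]]
    show "l2_ip y x = cnj (l2_ip x y)" by (simp add: l2_ip_def mult.commute)
  next
    fix x assume x: "x \<in> V"
    show "0 \<le> Re (l2_ip x x)" using l2_ip_self[OF V_l2[OF x]] by simp
    assume "l2_ip x x = 0"
    then have "l2norm x = 0" using l2_ip_self[OF V_l2[OF x]] by simp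
    then show "x = 0" using l2_coord[OF V_l2[OF x]] by (auto simp: fun_eq_iff)
  qed
  then interpret complex_inner_space l2_scale_op V l2_ip .
  have n: "nrm f = l2norm f" if "f \<in> V" for f
    using that l2_ip_self[OF V_l2[OF that]] V_l2[OF that] by (simp add: nrm_def)
  show "complex_hilbert_space l2_scale_op V l2_ip"
  proof
    fix \<sigma> :: "nat \<Rightarrow> nat \<Rightarrow> complex"
    assume \<sigma>: "\<And>n. \<sigma> n \<in> V" and cau: "\<And>e. 0 < e \<Longrightarrow> \<exists>N. \<forall>m\<ge>N. \<forall>n\<ge>N. nrm (\<sigma> m - \<sigma> n) < e"
    have sd: "\<sigma> m - \<sigma> n \<in> V" for m n by (rule subspace_diff[OF subspace_V \<sigma> \<sigma>])
    have "\<exists>N. \<forall>m\<ge>N. \<forall>n\<ge>N. l2norm (\<lambda>j. \<sigma> m j - \<sigma> n j) < e" if "0 < e" for e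
      using cau[OF that] by (simp add: n[OF sd]) (simp add: fun_diff_def)
    from l2_complete[OF V_l2[OF \<sigma>] this] obtain l
      where l: "l \<in> l2" and lim: "(\<lambda>n. l2norm (\<lambda>j. \<sigma> n j - l j)) \<longlonglongrightarrow> 0" by blast
    \<comment> \<open>\<open>V\<close> is closed: a coordinate of \<open>toep s\<close> is a
      continuous functional, and its value on \<open>\<sigma> n - l\<close> is
      \<open>- toep s l k\<close> for every \<open>n\<close>.\<close>
    have "toep s l k = 0" for k
    proof -
      have "cmod (toep s l k) \<le> l2norm (\<lambda>j. \<sigma> n j - l j)" for n
      proof -
        have "toep s (\<lambda>j. \<sigma> n j - l j) k = - toep s l k"
          using toep_diff[OF s_l2 V_l2[OF \<sigma>[of n]] l] V_toep[OF \<sigma>[of n]] by simp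
        then show ?thesis
          using toep_bound[OF s_l2 l2_diff(1)[OF V_l2[OF \<sigma>[of n]] l], of k] s_norm by simp
      qed
      then have "cmod (toep s l k) \<le> 0" by (intro tendsto_lowerbound[OF lim]) auto
      then show ?thesis by simp
    qed
    then have lV: "l \<in> V" using l by (simp add: model_space_def)
    have "nrm (\<sigma> n - l) = l2norm (\<lambda>j. \<sigma> n j - l j)" for n
      using n[OF subspace_diff[OF subspace_V \<sigma>[of n] lV]] by (simp add: fun_diff_def)
    then show "\<exists>l\<in>V. (\<lambda>n. nrm (\<sigma> n - l)) \<longlonglongrightarrow> 0"
      using lim lV by (intro bexI[of _ l]) simp
  qed
qed

lemma nrm_eq_l2norm: "f \<in> V \<Longrightarrow> nrm f = l2norm f"
  using l2_ip_self[OF V_l2] V_l2 by (simp add: nrm_def)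

lemma bshift_V: "f \<in> V \<Longrightarrow> bshift f \<in> V"
  using toep_shift[of s f 1] l2_shift(1)[of f 1] by (auto simp: model_space_def bshift_def)

lemma bounded_opI:
  assumes "\<And>f. f \<in> V \<Longrightarrow> A f \<in> V"
    and "\<And>f g. f \<in> V \<Longrightarrow> g \<in> V \<Longrightarrow> A (\<lambda>j. f j + g j) = (\<lambda>j. A f j + A g j)"
    and "\<And>a f. f \<in> V \<Longrightarrow> A (\<lambda>j. a * f j) = (\<lambda>j. a * A f j)"
    and "\<And>f. f \<in> V \<Longrightarrow> l2norm (A f) \<le> K * l2norm f"
  shows "bounded_op A"
  unfolding bounded_op_def using assms
  by (auto simp: nrm_eq_l2norm plus_fun_def l2_scale_op_def intro!: exI[of _ K])

lemma l2norm_bshift: "f \<in> V \<Longrightarrow> l2norm (bshift f) \<le> l2norm f"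
  using l2_shift(2)[OF V_l2, of f 1] by (simp add: bshift_def)

lemma bounded_op_bshift: "bounded_op bshift"
  by (rule bounded_opI[where K = 1]) (auto simp: bshift_V l2norm_bshift, auto simp: bshift_def)

lemma zero_V: "0 \<in> V"
  by (rule subspace_0[OF subspace_V])

lemma opnorm_le:
  assumes "\<And>f. f \<in> V \<Longrightarrow> l2norm f \<le> 1 \<Longrightarrow> A f \<in> V \<and> l2norm (A f) \<le> B"
  shows "opnorm A \<le> B"
  unfolding opnorm_def
proof (rule cSUP_least)
  have "(0 :: nat \<Rightarrow> complex) \<in> V" by (rule zero_V)
  then show "{f \<in> V. nrm f \<le> 1} \<noteq> {}"
    using nrm_scale_real[OF zero_V, of 0] by (force simp: l2_scale_op_def zero_fun_def)
  show "nrm (A f) \<le> B" if "f \<in> {f \<in> V. nrm f \<le> 1}" for f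
    using assms[of f] that by (auto simp: nrm_eq_l2norm)
qed

lemma contraction_bshift: "contraction bshift"
  unfolding contraction_def
  by (intro conjI bounded_op_bshift opnorm_le bshift_V order_trans[OF l2norm_bshift]) auto

text \<open>Transposition turns multiplication by z into the backward shift, and
  \<open>toep s\<close> vanishes on \<open>V\<close>; so the transpose of the hypothesis
  \<open>eq\<close>, restricted to \<open>V\<close>, says that \<open>toep u\<close> inverts the
  backward shift minus \<mu>.\<close>

lemma notin_spectrum_bshift:
  assumes u: "multiplier u B" and U: "power_series u U"
    and eq: "\<And>z. cmod z < 1 \<Longrightarrow> (z - \<mu>) * U z = 1 - \<gamma> * S z"
  shows "\<mu> \<notin> spectrum bshift"
proof -
  note ul = multiplier_l2(1)[OF u]
  \<comment> \<open>The coefficients of z times \<open>U\<close>; with them the hypothesis can be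
    compared coefficient by coefficient.\<close>
  define w where "w k = (if k = 0 then 0 else u (k - 1))" for k
  have "conv (\<lambda>k. if k = 1 then 1 else 0) u = w"
  proof
    fix k
    have "conv (\<lambda>k. if k = 1 then 1 else 0) u k = (\<Sum>i\<le>k. if i = 1 then u (k - 1) else 0)"
      unfolding conv_def by (intro sum.cong) auto
    then show "conv (\<lambda>k. if k = 1 then 1 else 0) u k = w k" by (simp add: w_def)
  qed
  with power_series_mult[OF power_series_monom[of 1 1] U]
  have w: "power_series w (\<lambda>z. z * U z)" by simp
  have "power_series (\<lambda>k. w k - \<mu> * u k) (\<lambda>z. z * U z - \<mu> * U z)"
    using U unfolding power_series_def
    by (intro power_series_diff[OF w, unfolded power_series_def]) (auto simp: mult.assoc intro!: sums_mult)
  then have 1: "power_series (\<lambda>k. w k - \<mu> * u k) (\<lambda>z. 1 - \<gamma> * S z)"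
    using eq unfolding power_series_def by (auto simp: left_diff_distrib)
  have "power_series (\<lambda>k. \<gamma> * s k) (\<lambda>z. \<gamma> * S z)"
    using s unfolding power_series_def by (auto simp: mult.assoc intro!: sums_mult)
  from power_series_diff[OF power_series_monom[of 0 1] this]
  have 2: "power_series (\<lambda>k. (if k = 0 then 1 else 0) - \<gamma> * s k) (\<lambda>z. 1 - \<gamma> * S z)" by simp
  have rec: "w k - \<mu> * u k = (if k = 0 then 1 else 0) - \<gamma> * s k" for k
    using fun_cong[OF power_series_unique[OF 1 2], of k] .
  have key: "toep u f (Suc j) - \<mu> * toep u f j = f j" if f: "f \<in> V" for f j
  proof -
    have "(\<lambda>k. u k * f (Suc j + k)) sums toep u f (Suc j)"
      unfolding toep_def by (rule summable_sums[OF toep_summable[OF ul V_l2[OF f]]])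
    then have "(\<lambda>k. w (Suc k) * f (j + Suc k)) sums toep u f (Suc j)" by (simp add: w_def)
    then have A: "(\<lambda>k. w k * f (j + k)) sums toep u f (Suc j)"
      by (subst (asm) sums_Suc_iff) (simp add: w_def)
    have B: "(\<lambda>k. u k * f (j + k)) sums toep u f j"
      unfolding toep_def by (rule summable_sums[OF toep_summable[OF ul V_l2[OF f]]])
    have C: "(\<lambda>k. s k * f (j + k)) sums 0"
      using summable_sums[OF toep_summable[OF s_l2 V_l2[OF f], of j]] V_toep[OF f, of j] by (simp add: toep_def)
    have D: "(\<lambda>k. if k = 0 then f (j + k) else 0) sums f (j + 0)" by (rule sums_single)
    have "(\<lambda>k. w k * f (j + k) - \<mu> * (u k * f (j + k))) sums (toep u f (Suc j) - \<mu> * toep u f j)"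
      by (intro sums_diff sums_mult A B)
    moreover have "(\<lambda>k. (if k = 0 then f (j + k) else 0) - \<gamma> * (s k * f (j + k))) sums (f (j + 0) - \<gamma> * 0)"
      by (intro sums_diff sums_mult C D)
    moreover have "w k * f (j + k) - \<mu> * (u k * f (j + k)) =
        (if k = 0 then f (j + k) else 0) - \<gamma> * (s k * f (j + k))" for k
      using arg_cong[OF rec[of k], of "\<lambda>x. x * f (j + k)"] by (auto simp: algebra_simps)
    ultimately show ?thesis by (simp add: sums_unique2)
  qed
  have "bounded_op (toep u)"
    by (rule bounded_opI[where K = B])
      (auto simp: toep_V[OF u] V_l2 toep_add ul toep_scale toep_l2(2)[OF u])
  moreover have "bshift (toep u f) - l2_scale_op \<mu> (toep u f) = f" if "f \<in> V" for f
    using key[OF that] by (auto simp: bshift_def l2_scale_op_def)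
  moreover have "toep u (bshift f - l2_scale_op \<mu> f) = f" if f: "f \<in> V" for f
  proof -
    have "bshift f - l2_scale_op \<mu> f = (\<lambda>j. bshift f j - \<mu> * f j)" by (auto simp: l2_scale_op_def)
    then have "toep u (bshift f - l2_scale_op \<mu> f) = (\<lambda>j. toep u (bshift f) j - \<mu> * toep u f j)"
      using f by (simp add: toep_diff toep_scale ul V_l2 bshift_V l2_scale)
    moreover have "toep u (bshift f) j = toep u f (Suc j)" for j
      using toep_shift[of u f 1 j] by (simp add: bshift_def)
    ultimately show ?thesis using key[OF f] by auto
  qed
  ultimately show ?thesis unfolding spectrum_def invertible_op_def by auto
qed

section \<open>Powers of the inverse of the backward shift\<close>

context
  assumes spec: "0 \<notin> spectrum bshift"
begin

lemma invertible_bshift: "invertible_op bshift"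
  using invertible_op_if_0_notin_spectrum[OF spec] .

lemmas inv_bshift = invertible_op_inv_into[OF bounded_op_bshift invertible_bshift]

lemma bounded_op_comp:
  assumes A: "bounded_op A" and B: "bounded_op B"
  shows "bounded_op (\<lambda>x. A (B x))"
proof -
  obtain K L where K: "\<forall>x\<in>V. nrm (A x) \<le> K * nrm x" and L: "\<forall>x\<in>V. nrm (B x) \<le> L * nrm x"
    using A B by (auto simp: bounded_op_def)
  have "nrm (A (B x)) \<le> \<bar>K\<bar> * L * nrm x" if x: "x \<in> V" for x
  proof -
    have Bx: "B x \<in> V" using B x by (simp add: bounded_op_def)
    then have "nrm (A (B x)) \<le> K * nrm (B x)" using K by blast
    also have "\<dots> \<le> \<bar>K\<bar> * nrm (B x)"
      using V_l2[OF Bx] by (intro mult_right_mono) (auto simp: nrm_eq_l2norm Bx)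
    also have "\<dots> \<le> \<bar>K\<bar> * (L * nrm x)" using L x by (intro mult_left_mono) auto
    finally show ?thesis by (simp add: mult.assoc)
  qed
  then show ?thesis using A B by (auto simp: bounded_op_def)
qed

lemma inv_pow_Suc: "inv_pow bshift (Suc n) x = inv_into V bshift (inv_pow bshift n x)"
  by (simp add: inv_pow_def)

lemma bounded_op_inv_pow: "bounded_op (inv_pow bshift n)"
proof (induction n)
  case 0
  show ?case by (rule bounded_opI[where K = 1]) (auto simp: inv_pow_def)
next
  case (Suc n)
  have "inv_pow bshift (Suc n) = (\<lambda>x. inv_into V bshift (inv_pow bshift n x))"
    by (rule ext) (rule inv_pow_Suc)
  then show ?case using bounded_op_comp[OF inv_bshift(1) Suc] by simp
qed

lemma inv_pow_V: "x \<in> V \<Longrightarrow> inv_pow bshift n x \<in> V"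
  using bounded_op_inv_pow by (simp add: bounded_op_def)

text \<open>Each application of the inverse prepends one coordinate, so only the first
  \<open>n\<close> coordinates of \<open>inv_pow bshift n x\<close> remain to be found.\<close>

lemma inv_pow_tail: "x \<in> V \<Longrightarrow> inv_pow bshift n x (j + n) = x j"
proof (induction n arbitrary: j)
  case 0
  show ?case by (simp add: inv_pow_def)
next
  case (Suc n)
  have "bshift (inv_pow bshift (Suc n) x) = inv_pow bshift n x"
    unfolding inv_pow_Suc by (rule inv_bshift(3)[OF inv_pow_V[OF Suc.prems]])
  from fun_cong[OF this, of "j + n"]
  show ?case using Suc.IH[OF Suc.prems, of j] bshift_apply by (metis add_Suc_right)
qed

text \<open>The first \<open>n\<close> coordinates of \<open>y \<in> V\<close>, read backwards, solve a triangular Toeplitz system with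
  symbol \<open>S\<close> whose right-hand side depends on the remaining coordinates only.\<close>

lemma head_eq_conv:
  assumes y: "y \<in> V" and m: "m < n"
  shows "y (n - 1 - m) = conv c (\<lambda>m. - (\<Sum>i. s (i + m + 1) * y (i + n))) m"
proof -
  define Y where "Y m = (if m < n then y (n - 1 - m) else 0)" for m
  have head: "conv s Y m = - (\<Sum>i. s (i + m + 1) * y (i + n))" if "m < n" for m
  proof -
    have sm: "summable (\<lambda>i. s i * y (n - 1 - m + i))"
      by (rule toep_summable[OF s_l2 V_l2[OF y]])
    have "0 = (\<Sum>i. s i * y (n - 1 - m + i))" using V_toep[OF y] by (simp add: toep_def)
    also have "\<dots> = (\<Sum>i. s (i + Suc m) * y (n - 1 - m + (i + Suc m))) + (\<Sum>i<Suc m. s i * y (n - 1 - m + i))"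
      by (rule suminf_split_initial_segment[OF sm])
    also have "(\<Sum>i<Suc m. s i * y (n - 1 - m + i)) = conv s Y m"
      unfolding conv_def using that by (intro sum.cong) (auto simp: Y_def intro!: arg_cong[where f = y])
    also have "(\<lambda>i. s (i + Suc m) * y (n - 1 - m + (i + Suc m))) = (\<lambda>i. s (i + m + 1) * y (i + n))"
      using that by (auto simp: algebra_simps fun_eq_iff intro!: arg_cong[where f = y])
    finally show ?thesis by (simp add: eq_neg_iff_add_eq_0 add.commute)
  qed
  obtain G where G: "power_series Y G"
    using l2_power_series[OF l2_finite_support[of n Y]] by (auto simp: Y_def)
  have "power_series (conv c (conv s Y)) (\<lambda>z. C z * (S z * G z))"
    by (intro power_series_mult c s G)
  then have "power_series (conv c (conv s Y)) G"
    using SC unfolding power_series_def by (simp add: mult.assoc[symmetric])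
  from power_series_unique[OF this G] have "conv c (conv s Y) m = Y m" by simp
  \<comment> \<open>Entry \<open>m\<close> of a convolution involves only entries up to
    \<open>m\<close>, so knowing \<open>conv s Y\<close> below \<open>n\<close> is enough.\<close>
  moreover have "conv c (conv s Y) m = conv c (\<lambda>m. - (\<Sum>i. s (i + m + 1) * y (i + n))) m"
    unfolding conv_def[of c] using m by (intro sum.cong) (auto simp: head)
  ultimately show ?thesis using m by (simp add: Y_def)
qed

text \<open>The coordinates from \<open>n\<close> on are those of \<open>x\<close>. For the others,
  Cauchy-Schwarz bounds the right-hand sides in \<open>head_eq_conv\<close> by 1, and convolution
  with \<open>c\<close> costs at most the sum of the |c_i|.\<close>

lemma opnorm_inv_pow_le: "opnorm (inv_pow bshift n) \<le> 1 + real n * (\<Sum>i<n. cmod (c i))"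
proof (rule opnorm_le, rule conjI)
  fix x assume x: "x \<in> V" and x1: "l2norm x \<le> 1"
  define y where "y = inv_pow bshift n x"
  show yV: "inv_pow bshift n x \<in> V" by (rule inv_pow_V[OF x])
  then have yl: "y \<in> l2" using V_l2 by (simp add: y_def)
  have tail: "y (j + n) = x j" for j unfolding y_def by (rule inv_pow_tail[OF x])
  define K where "K = (\<Sum>i<n. cmod (c i))"
  have K: "0 \<le> K" by (simp add: K_def sum_nonneg)
  have rhs: "cmod (\<Sum>i. s (i + m + 1) * x i) \<le> 1" for m
  proof -
    have "cmod (\<Sum>i. s (i + m + 1) * x i) \<le> l2norm (\<lambda>i. s (i + (m + 1))) * l2norm x"
      using l2_mult(3)[OF l2_shift(1)[OF s_l2, of "m + 1"] V_l2[OF x]] by (simp add: add.assoc)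
    also have "\<dots> \<le> 1 * 1"
      using l2_shift(2)[OF s_l2, of "m + 1"] s_norm x1 V_l2[OF x] by (intro mult_mono) auto
    finally show ?thesis by simp
  qed
  have coord: "cmod (y k) \<le> K" if "k < n" for k
  proof -
    have "y k = conv c (\<lambda>m. - (\<Sum>i. s (i + m + 1) * x i)) (n - 1 - k)"
      using head_eq_conv[OF yV[folded y_def], of "n - 1 - k" n] that by (simp add: tail)
    also have "cmod \<dots> \<le> (\<Sum>i\<le>n - 1 - k. cmod (c i) * 1)"
      unfolding conv_def using rhs by (intro sum_norm_le) (auto simp: norm_mult intro!: mult_left_le)
    also have "\<dots> \<le> K"
      unfolding K_def using that by (simp, intro sum_mono2) auto
    finally show ?thesis .
  qed
  have "(l2norm y)\<^sup>2 = (\<Sum>j. (cmod (y (j + n)))\<^sup>2) + (\<Sum>j<n. (cmod (y j))\<^sup>2)"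
    unfolding l2norm_sq[OF yl] using yl by (intro suminf_split_initial_segment) (simp add: l2_def)
  also have "(\<Sum>j. (cmod (y (j + n)))\<^sup>2) = (l2norm x)\<^sup>2"
    by (simp add: tail l2norm_sq[OF V_l2[OF x]])
  also have "(l2norm x)\<^sup>2 \<le> 1\<^sup>2" using x1 V_l2[OF x] by (intro power_mono) auto
  also have "(\<Sum>j<n. (cmod (y j))\<^sup>2) \<le> (real n * K)\<^sup>2"
  proof -
    have "(\<Sum>j<n. (cmod (y j))\<^sup>2) \<le> (\<Sum>j<n. K\<^sup>2)" using coord by (intro sum_mono power_mono) auto
    also have "\<dots> = real n * K\<^sup>2" by simp
    \<comment> \<open>Giving up sqrt n for n turns the bound into a square; the margin exp(n^b / 4)
      of the coefficients absorbs such factors later.\<close>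
    also have "\<dots> \<le> (real n)\<^sup>2 * K\<^sup>2"
      by (intro mult_right_mono) (cases n, auto simp: power2_eq_square)
    also have "\<dots> = (real n * K)\<^sup>2" by (simp add: power_mult_distrib)
    finally show ?thesis .
  qed
  finally have "(l2norm y)\<^sup>2 \<le> (1 + real n * K)\<^sup>2"
    using mult_nonneg_nonneg[OF of_nat_0_le_iff[of n] K] by (simp add: power2_sum)
  then show "l2norm (inv_pow bshift n x) \<le> 1 + real n * (\<Sum>i<n. cmod (c i))"
    unfolding y_def[symmetric] K_def[symmetric] using K by (intro power2_le_imp_le[of "l2norm y"]) auto
qed

lemma opnorm_nonneg:
  assumes "bounded_op A"
  shows "0 \<le> opnorm A"
proof -
  obtain K where K: "\<forall>x\<in>V. nrm (A x) \<le> K * nrm x" using assms by (auto simp: bounded_op_def)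
  have n0: "nrm x \<ge> 0" if "x \<in> V" for x using that V_l2 by (simp add: nrm_eq_l2norm)
  have "nrm (A x) \<le> \<bar>K\<bar>" if "x \<in> V" "nrm x \<le> 1" for x
  proof -
    have "nrm (A x) \<le> K * nrm x" using K that by blast
    also have "\<dots> \<le> \<bar>K\<bar> * 1" using that n0[OF that(1)] by (intro mult_mono) auto
    finally show ?thesis by simp
  qed
  then have "bdd_above ((\<lambda>x. nrm (A x)) ` {x \<in> V. nrm x \<le> 1})" by (intro bdd_aboveI2) auto
  moreover have "nrm 0 = 0" by (simp add: nrm_def l2_ip_def)
  ultimately have "nrm (A 0) \<le> opnorm A"
    unfolding opnorm_def using zero_V by (intro cSUP_upper[of 0]) auto
  moreover have "A 0 \<in> V" using assms zero_V by (simp add: bounded_op_def)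
  ultimately show ?thesis using n0 by fastforce
qed

text \<open>For this vector the right-hand side in \<open>head_eq_conv\<close> is, up to sign, a
  unit impulse minus a multiple of \<open>s\<close>. Convolution with \<open>c\<close> turns the
  impulse into \<open>c\<close>, and \<open>s\<close> into an impulse at 0, which is not seen at the
  positive index \<open>Suc n\<close>.\<close>

lemma opnorm_inv_pow_ge: "cmod (c (Suc n)) \<le> opnorm (inv_pow bshift (Suc (Suc n)))"
proof -
  define N where "N = Suc (Suc n)"
  define x where "x j = cnj (s (Suc j))" for j
  have xl: "x \<in> l2"
    using l2_cnj(1)[OF l2_shift(1)[OF s_l2, of 1]] by (simp add: x_def[abs_def])
  have xn: "l2norm x \<le> 1"
    using l2_cnj(2)[of "\<lambda>j. s (j + 1)"] l2_shift(2)[OF s_l2, of 1] s_norm by (simp add: x_def[abs_def])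
  \<comment> \<open>Autocorrelations of \<open>s\<close> vanish at nonzero lag because S is inner;
    the subtracted term is the entry \<open>j = 0\<close>, which the shift in \<open>x\<close>
    drops.\<close>
  have corr: "(\<Sum>i. s (i + m + 1) * x i) = (if m = 0 then 1 else 0) - s m * cnj (s 0)" for m
  proof -
    have "summable (\<lambda>j. s (j + m) * cnj (s j))"
      by (rule l2_mult(2)[OF l2_shift(1)[OF s_l2] l2_cnj(1)[OF s_l2]])
    from suminf_split_initial_segment[OF this, of 1]
    have "(\<Sum>j. s (j + m) * cnj (s j)) = (\<Sum>i. s (i + m + 1) * x i) + s m * cnj (s 0)"
      by (simp add: x_def)
    moreover have "(\<Sum>j. s (j + m) * cnj (s j)) = (if m = 0 then 1 else 0)"
      using inner_orthogonal_shift[OF s_multiplier s_norm, of m] l2_ip_self[OF s_l2]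
      by (simp add: l2_ip_def s_norm)
    ultimately show ?thesis by (simp add: algebra_simps)
  qed
  have xV: "x \<in> V"
  proof -
    have "toep s x k = 0" for k
    proof -
      have "toep s x k = cnj (\<Sum>j. s (j + (k + 1)) * cnj (s j))"
        unfolding toep_def x_def
        using bounded_linear.suminf[OF bounded_linear_cnj
            l2_mult(2)[OF l2_shift(1)[OF s_l2, of "k + 1"] l2_cnj(1)[OF s_l2]]]
        by (simp add: mult.commute add_ac)
      then show ?thesis using inner_orthogonal_shift[OF s_multiplier s_norm, of "k + 1"] by simp
    qed
    then show ?thesis using xl by (simp add: model_space_def)
  qed
  define y where "y = inv_pow bshift N x"
  have yV: "y \<in> V" unfolding y_def by (rule inv_pow_V[OF xV])
  have tail: "y (j + N) = x j" for j unfolding y_def by (rule inv_pow_tail[OF xV])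
  have cs: "conv c s = (\<lambda>k. if k = 0 then 1 else 0)"
  proof (rule power_series_unique)
    show "power_series (conv c s) (\<lambda>z. C z * S z)" by (rule power_series_mult[OF c s])
    show "power_series (\<lambda>k. if k = 0 then 1 else 0) (\<lambda>z. C z * S z)"
      using power_series_monom[of 0 1] SC by (simp add: power_series_def)
  qed
  \<comment> \<open>With \<open>N = n + 2\<close> this is the coordinate 0 of
    \<open>y\<close>.\<close>
  have "y (N - 1 - Suc n) = conv c (\<lambda>m. - (\<Sum>i. s (i + m + 1) * y (i + N))) (Suc n)"
    by (rule head_eq_conv[OF yV]) (simp add: N_def)
  then have "y 0 = conv c (\<lambda>m. - ((if m = 0 then 1 else 0) - s m * cnj (s 0))) (Suc n)"
    unfolding tail corr by (simp add: N_def)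
  also have "\<dots> = cnj (s 0) * conv c s (Suc n) - (\<Sum>i\<le>Suc n. if i = Suc n then c (Suc n) else 0)"
    unfolding conv_def sum_distrib_left sum_subtractf[symmetric]
    by (intro sum.cong) (auto simp: algebra_simps)
  also have "\<dots> = - c (Suc n)" by (simp add: cs)
  finally have "cmod (c (Suc n)) = cmod (y 0)" by simp
  also have "\<dots> \<le> l2norm y" by (rule l2_coord[OF V_l2[OF yV]])
  also have "\<dots> = nrm (inv_pow bshift N x)" using nrm_eq_l2norm[OF yV] by (simp add: y_def)
  also have "\<dots> \<le> opnorm (inv_pow bshift N) * nrm x"
    by (rule nrm_le_opnorm[OF bounded_op_inv_pow xV])
  also have "\<dots> \<le> opnorm (inv_pow bshift N) * 1"
    using xn by (intro mult_left_mono opnorm_nonneg[OF bounded_op_inv_pow]) (simp add: nrm_eq_l2norm[OF xV])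
  finally show ?thesis by (simp add: N_def)
qed

end

end

section \<open>The Cantor set and averages over it\<close>

primrec cantor_level :: "real \<Rightarrow> nat \<Rightarrow> real set" where
  "cantor_level \<xi> 0 = {0..1}"
| "cantor_level \<xi> (Suc N) = (\<lambda>t. \<xi> * t) ` cantor_level \<xi> N \<union> (\<lambda>t. \<xi> * t + (1 - \<xi>)) ` cantor_level \<xi> N"

definition cantor_set :: "real \<Rightarrow> real set"
  where "cantor_set \<xi> = (\<Inter>N. cantor_level \<xi> N)"

text \<open>The average of \<open>f\<close> over the \<open>2\<^sup>N\<close> left end points of the intervals of level \<open>N\<close>.\<close>

primrec cantor_mean :: "real \<Rightarrow> nat \<Rightarrow> (real \<Rightarrow> 'a::real_normed_vector) \<Rightarrow> 'a" where
  "cantor_mean \<xi> 0 f = f 0"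
| "cantor_mean \<xi> (Suc N) f =
    (1/2) *\<^sub>R (cantor_mean \<xi> N (\<lambda>t. f (\<xi> * t)) + cantor_mean \<xi> N (\<lambda>t. f (\<xi> * t + (1 - \<xi>))))"

locale cantor =
  fixes \<xi> :: real
  assumes xi: "0 < \<xi>" "\<xi> < 1/2"
begin

lemma affine_unit:
  assumes "t \<in> {0..1}"
  shows "\<xi> * t \<in> {0..1}" and "\<xi> * t + (1 - \<xi>) \<in> {0..1}"
proof -
  have "0 \<le> \<xi> * t" "\<xi> * t \<le> \<xi>" using assms xi by (auto intro: mult_left_le)
  then show "\<xi> * t \<in> {0..1}" and "\<xi> * t + (1 - \<xi>) \<in> {0..1}"
    using xi unfolding atLeastAtMost_iff by linarith+
qed

lemma cantor_level_Suc_subset: "cantor_level \<xi> (Suc N) \<subseteq> cantor_level \<xi> N"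
proof (induction N)
  case 0
  then show ?case using affine_unit by auto
next
  case (Suc N)
  have "(\<lambda>t. \<xi> * t) ` cantor_level \<xi> (Suc N) \<subseteq> (\<lambda>t. \<xi> * t) ` cantor_level \<xi> N"
    "(\<lambda>t. \<xi> * t + (1 - \<xi>)) ` cantor_level \<xi> (Suc N) \<subseteq> (\<lambda>t. \<xi> * t + (1 - \<xi>)) ` cantor_level \<xi> N"
    using Suc by (intro image_mono; blast)+
  then show ?case
    unfolding cantor_level.simps(2)[of \<xi> "Suc N"] cantor_level.simps(2)[of \<xi> N] by blast
qed

lemma cantor_level_antimono: "M \<le> N \<Longrightarrow> cantor_level \<xi> N \<subseteq> cantor_level \<xi> M"
  by (rule lift_Suc_antimono_le[of "cantor_level \<xi>"]) (rule cantor_level_Suc_subset)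

lemma compact_cantor_level: "compact (cantor_level \<xi> N)"
  by (induction N) (auto intro!: compact_Un compact_continuous_image continuous_intros)

lemma compact_cantor_set: "compact (cantor_set \<xi>)"
  unfolding cantor_set_def by (intro compact_Inter) (auto simp: compact_cantor_level)

lemma cantor_set_unit: "cantor_set \<xi> \<subseteq> {0..1}"
  unfolding cantor_set_def by (metis INT_lower UNIV_I cantor_level.simps(1))

lemma cantor_set_affine:
  assumes "t \<in> cantor_set \<xi>"
  shows "\<xi> * t \<in> cantor_set \<xi>" and "\<xi> * t + (1 - \<xi>) \<in> cantor_set \<xi>"
proof -
  have "\<xi> * t \<in> cantor_level \<xi> N \<and> \<xi> * t + (1 - \<xi>) \<in> cantor_level \<xi> N" for N
    using assms affine_unit[of t] cantor_set_unit unfolding cantor_set_def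
    by (cases N) auto
  then show "\<xi> * t \<in> cantor_set \<xi>" and "\<xi> * t + (1 - \<xi>) \<in> cantor_set \<xi>"
    unfolding cantor_set_def by auto
qed

lemma zero_cantor_set: "0 \<in> cantor_set \<xi>"
proof -
  have "0 \<in> cantor_level \<xi> N" for N by (induction N) (auto simp: image_iff)
  then show ?thesis by (simp add: cantor_set_def)
qed

text \<open>If both preimages of \<open>t\<close> left the Cantor set, they would both be missing
  from some common level, by monotonicity, and \<open>t\<close> from the next one.\<close>

lemma cantor_set_split:
  assumes "t \<in> cantor_set \<xi>"
  shows "\<exists>t'\<in>cantor_set \<xi>. \<exists>b\<in>{0,1}. t = (1 - \<xi>) * b + \<xi> * t'"
proof (rule ccontr)
  define t0 where "t0 = t / \<xi>"
  define t1 where "t1 = (t - (1 - \<xi>)) / \<xi>"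
  have t0: "t = \<xi> * x \<longleftrightarrow> x = t0" and t1: "t = \<xi> * x + (1 - \<xi>) \<longleftrightarrow> x = t1" for x
    using xi by (auto simp: t0_def t1_def field_simps)
  assume "\<not> ?thesis"
  then have "t0 \<notin> cantor_set \<xi>" "t1 \<notin> cantor_set \<xi>" using t0[of t0] t1[of t1] by auto
  then obtain M N where "t0 \<notin> cantor_level \<xi> M" "t1 \<notin> cantor_level \<xi> N" by (auto simp: cantor_set_def)
  then have "t0 \<notin> cantor_level \<xi> (max M N)" "t1 \<notin> cantor_level \<xi> (max M N)"
    using cantor_level_antimono[of M "max M N"] cantor_level_antimono[of N "max M N"] by auto
  moreover have "t \<in> cantor_level \<xi> (Suc (max M N))" using assms unfolding cantor_set_def by blast
  ultimately show False by (auto simp: t0 t1)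
qed

text \<open>Iterating \<open>cantor_set_split\<close> produces the digits; the remainder
  \<open>\<xi> ^ N * X N\<close> tends to 0 because all \<open>X N\<close> stay in [0,1].\<close>

lemma circ_cantor_set_subset: "circ ` cantor_set \<xi> \<subseteq> perfect_symmetric_set \<xi>"
proof
  fix z assume "z \<in> circ ` cantor_set \<xi>"
  then obtain x where z: "z = circ x" and x: "x \<in> cantor_set \<xi>" by blast
  have "\<forall>t\<in>cantor_set \<xi>. \<exists>p. fst p \<in> cantor_set \<xi> \<and> snd p \<in> {0, 1} \<and> t = (1 - \<xi>) * snd p + \<xi> * fst p"
  proof
    fix t assume "t \<in> cantor_set \<xi>"
    from cantor_set_split[OF this] obtain t' b
      where "t' \<in> cantor_set \<xi>" "b \<in> {0, 1}" "t = (1 - \<xi>) * b + \<xi> * t'" by blast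
    then show "\<exists>p. fst p \<in> cantor_set \<xi> \<and> snd p \<in> {0, 1} \<and> t = (1 - \<xi>) * snd p + \<xi> * fst p"
      by (intro exI[of _ "(t', b)"]) auto
  qed
  then obtain p where p: "\<And>t. t \<in> cantor_set \<xi> \<Longrightarrow> fst (p t) \<in> cantor_set \<xi>"
      "\<And>t. t \<in> cantor_set \<xi> \<Longrightarrow> snd (p t) \<in> {0, 1}"
      "\<And>t. t \<in> cantor_set \<xi> \<Longrightarrow> t = (1 - \<xi>) * snd (p t) + \<xi> * fst (p t)"
    by metis
  define X where "X n = ((\<lambda>t. fst (p t)) ^^ n) x" for n
  \<comment> \<open>Digits are indexed from 1, as in the definition of the symmetric set; truncated
    subtraction makes \<open>d 0\<close> a copy of \<open>d 1\<close>.\<close>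
  define d where "d n = snd (p (X (n - 1)))" for n
  have X: "X n \<in> cantor_set \<xi>" for n by (induction n) (auto simp: X_def x p)
  have expand: "x = (1 - \<xi>) * (\<Sum>n<N. d (Suc n) * \<xi> ^ n) + \<xi> ^ N * X N" for N
  proof (induction N)
    case 0
    then show ?case by (simp add: X_def)
  next
    case (Suc N)
    have "X N = (1 - \<xi>) * d (Suc N) + \<xi> * X (Suc N)"
      using p(3)[OF X[of N]] by (simp add: d_def X_def)
    then have "\<xi> ^ N * X N = \<xi> ^ N * ((1 - \<xi>) * d (Suc N) + \<xi> * X (Suc N))" by (rule arg_cong)
    also have "\<dots> = (1 - \<xi>) * (d (Suc N) * \<xi> ^ N) + \<xi> ^ Suc N * X (Suc N)"
      by (simp add: algebra_simps)
    finally have "\<xi> ^ N * X N = (1 - \<xi>) * (d (Suc N) * \<xi> ^ N) + \<xi> ^ Suc N * X (Suc N)" .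
    with Suc show ?case by (simp add: algebra_simps)
  qed
  have d01: "d n \<in> {0, 1}" for n unfolding d_def by (rule p(2)[OF X])
  have "(\<lambda>N. \<xi> ^ N * X N) \<longlonglongrightarrow> 0"
  proof (rule tendsto_rabs_zero_cancel, rule tendsto_sandwich[of "\<lambda>_. 0" _ _ "\<lambda>N. \<xi> ^ N"])
    have "\<bar>\<xi> ^ N * X N\<bar> \<le> \<xi> ^ N" for N
      using X[of N] cantor_set_unit xi by (auto simp: abs_mult intro!: mult_left_le)
    then show "\<forall>\<^sub>F N in sequentially. \<bar>\<xi> ^ N * X N\<bar> \<le> \<xi> ^ N" by simp
    show "(\<lambda>N. \<xi> ^ N) \<longlonglongrightarrow> 0" using xi by (intro LIMSEQ_realpow_zero) auto
  qed auto
  then have "(\<lambda>N. (x - \<xi> ^ N * X N) / (1 - \<xi>)) \<longlonglongrightarrow> (x - 0) / (1 - \<xi>)"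
    using xi by (intro tendsto_intros) auto
  moreover have "(x - \<xi> ^ N * X N) / (1 - \<xi>) = (\<Sum>n<N. d (Suc n) * \<xi> ^ n)" for N
    using expand[of N] xi by (simp add: field_simps)
  ultimately have "(\<lambda>n. d (Suc n) * \<xi> ^ n) sums (x / (1 - \<xi>))" by (simp add: sums_def)
  then have "x = (1 - \<xi>) * (\<Sum>n. d (Suc n) * \<xi> ^ n)" using xi by (simp add: sums_iff)
  then have "complex_of_real (2 * pi * x) = 2 * of_real pi * of_real (1 - \<xi>) * of_real (\<Sum>n. d (Suc n) * \<xi> ^ n)"
    by (metis mult.assoc of_real_mult of_real_numeral)
  then have "z = exp (2 * \<i> * of_real pi * of_real (1 - \<xi>) * of_real (\<Sum>n. d (Suc n) * \<xi> ^ n))"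
    unfolding z circ_def cis_conv_exp by (simp only: mult_ac)
  then show "z \<in> perfect_symmetric_set \<xi>"
    unfolding perfect_symmetric_set_def using d01 by blast
qed

text \<open>A level consists of two copies of the previous one shrunk by \<xi>, so lengths decay
  like (2 \<xi>)^N. Nullity makes the radial limits of |S| equal to 1 almost everywhere.\<close>

lemma negligible_cantor_set: "negligible (cantor_set \<xi>)"
proof -
  have lm: "cantor_level \<xi> N \<in> lmeasurable" for N by (rule lmeasurable_compact[OF compact_cantor_level])
  have le: "measure lebesgue (cantor_level \<xi> N) \<le> (2 * \<xi>) ^ N" for N
  proof (induction N)
    case 0
    then show ?case by simp
  next
    case (Suc N)
    let ?A = "(\<lambda>t. \<xi> * t) ` cantor_level \<xi> N" and ?B = "(\<lambda>t. \<xi> * t + (1 - \<xi>)) ` cantor_level \<xi> N"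
    have AB: "?A \<in> lmeasurable" "?B \<in> lmeasurable"
      by (intro lmeasurable_compact compact_continuous_image compact_cantor_level continuous_intros)+
    have "measure lebesgue (?A \<union> ?B) \<le> measure lebesgue ?A + measure lebesgue ?B"
      using AB by (intro measure_Un_le) (auto simp: fmeasurable_def)
    also have "\<dots> = 2 * \<xi> * measure lebesgue (cantor_level \<xi> N)"
      using measure_lebesgue_affine[of \<xi> 0 "cantor_level \<xi> N"]
        measure_lebesgue_affine[of \<xi> "1 - \<xi>" "cantor_level \<xi> N"] xi by simp
    also have "\<dots> \<le> 2 * \<xi> * (2 * \<xi>) ^ N" using Suc xi by (intro mult_left_mono) auto
    finally show ?case by simp
  qed
  have "measure lebesgue (cantor_set \<xi>) \<le> (2 * \<xi>) ^ N" for N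
    using measure_mono_fmeasurable[OF _ _ lm[of N], of "cantor_set \<xi>"] le[of N]
      lmeasurable_compact[OF compact_cantor_set]
    by (force simp: cantor_set_def fmeasurable_def)
  moreover have "(\<lambda>N. (2 * \<xi>) ^ N) \<longlonglongrightarrow> 0" using xi by (intro LIMSEQ_realpow_zero) auto
  ultimately have "measure lebesgue (cantor_set \<xi>) \<le> 0" by (intro tendsto_lowerbound[of _ 0 sequentially]) auto
  then show ?thesis
    using lmeasurable_compact[OF compact_cantor_set] by (simp add: negligible_iff_measure measure_le_0_iff)
qed

text \<open>The nodes of the average lie in the Cantor set, since 0 does and both affine maps
  preserve it; assumptions on \<open>f\<close> are therefore made there only, away from the
  singularities of the kernels.\<close>

lemma mean_norm_le:
  assumes "\<And>t. t \<in> cantor_set \<xi> \<Longrightarrow> norm (f t) \<le> B"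
  shows "norm (cantor_mean \<xi> N f) \<le> B"
  using assms
proof (induction N arbitrary: f)
  case 0
  then show ?case using zero_cantor_set by simp
next
  case (Suc N)
  have "norm (cantor_mean \<xi> N (\<lambda>t. f (\<xi> * t))) \<le> B" "norm (cantor_mean \<xi> N (\<lambda>t. f (\<xi> * t + (1 - \<xi>)))) \<le> B"
    by (rule Suc.IH, simp add: Suc.prems cantor_set_affine)+
  then show ?case
    by (simp, intro norm_triangle_le) simp
qed

lemma mean_mono:
  fixes f g :: "real \<Rightarrow> real"
  assumes "\<And>t. t \<in> cantor_set \<xi> \<Longrightarrow> f t \<le> g t"
  shows "cantor_mean \<xi> N f \<le> cantor_mean \<xi> N g"
  using assms
proof (induction N arbitrary: f g)
  case 0
  then show ?case using zero_cantor_set by simp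
next
  case (Suc N)
  have "cantor_mean \<xi> N (\<lambda>t. f (\<xi> * t)) \<le> cantor_mean \<xi> N (\<lambda>t. g (\<xi> * t))"
    "cantor_mean \<xi> N (\<lambda>t. f (\<xi> * t + (1 - \<xi>))) \<le> cantor_mean \<xi> N (\<lambda>t. g (\<xi> * t + (1 - \<xi>)))"
    by (rule Suc.IH, simp add: Suc.prems cantor_set_affine)+
  then show ?case by simp
qed

lemma mean_const [simp]: "cantor_mean \<xi> N (\<lambda>_. a) = a"
  by (induction N) (auto simp flip: scaleR_2)

lemma mean_add: "cantor_mean \<xi> N (\<lambda>t. f t + g t) = cantor_mean \<xi> N f + cantor_mean \<xi> N g"
  by (induction N arbitrary: f g) (simp_all add: algebra_simps)

lemma mean_diff: "cantor_mean \<xi> N (\<lambda>t. f t - g t) = cantor_mean \<xi> N f - cantor_mean \<xi> N g"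
  by (induction N arbitrary: f g) (simp_all add: add_diff_add flip: scaleR_diff_right)

lemma mean_scale:
  fixes f :: "real \<Rightarrow> real"
  shows "cantor_mean \<xi> N (\<lambda>t. a * f t) = a * cantor_mean \<xi> N f"
  by (induction N arbitrary: f) (simp_all add: algebra_simps)

lemma Re_mean: "Re (cantor_mean \<xi> N f) = cantor_mean \<xi> N (\<lambda>t. Re (f t))"
  by (induction N arbitrary: f) simp_all

lemma holomorphic_mean:
  assumes "\<And>t. t \<in> cantor_set \<xi> \<Longrightarrow> (\<lambda>z. f z t) holomorphic_on A"
  shows "(\<lambda>z. cantor_mean \<xi> N (f z)) holomorphic_on A"
  using assms
proof (induction N arbitrary: f)
  case 0
  then show ?case using zero_cantor_set by simp
next
  case (Suc N)
  have "(\<lambda>z. cantor_mean \<xi> N (\<lambda>t. f z (\<xi> * t))) holomorphic_on A"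
    "(\<lambda>z. cantor_mean \<xi> N (\<lambda>t. f z (\<xi> * t + (1 - \<xi>)))) holomorphic_on A"
    by (rule Suc.IH, simp add: Suc.prems cantor_set_affine)+
  then show ?case by (auto simp: scaleR_conv_of_real intro!: holomorphic_intros)
qed

text \<open>Composition with either affine map shrinks the Lipschitz constant by \<xi>. After
  \<open>N\<close> steps an average is compared with the value at 0, from which \<open>f\<close>
  differs by at most the remaining constant, whatever \<open>p\<close> is.\<close>

lemma mean_Cauchy:
  fixes f :: "real \<Rightarrow> 'a::real_normed_vector"
  assumes "\<And>x y. x \<in> cantor_set \<xi> \<Longrightarrow> y \<in> cantor_set \<xi> \<Longrightarrow> norm (f x - f y) \<le> L * \<bar>x - y\<bar>" and "0 \<le> L"
  shows "norm (cantor_mean \<xi> (N + p) f - cantor_mean \<xi> N f) \<le> L * \<xi> ^ N"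
  using assms
proof (induction N arbitrary: f L)
  case 0
  have "norm (cantor_mean \<xi> p (\<lambda>t. f t - f 0)) \<le> L"
  proof (rule mean_norm_le)
    fix t assume t: "t \<in> cantor_set \<xi>"
    then have "norm (f t - f 0) \<le> L * \<bar>t\<bar>" using 0(1)[of t 0] zero_cantor_set by simp
    also have "\<dots> \<le> L * 1" using t cantor_set_unit 0(2) by (intro mult_left_mono) auto
    finally show "norm (f t - f 0) \<le> L" by simp
  qed
  then show ?case by (simp add: mean_diff)
next
  case (Suc N)
  let ?f0 = "\<lambda>t. f (\<xi> * t)" and ?f1 = "\<lambda>t. f (\<xi> * t + (1 - \<xi>))"
  have "norm (?f0 x - ?f0 y) \<le> (L * \<xi>) * \<bar>x - y\<bar>" if "x \<in> cantor_set \<xi>" "y \<in> cantor_set \<xi>" for x y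
    using Suc.prems(1)[OF cantor_set_affine(1)[OF that(1)] cantor_set_affine(1)[OF that(2)]] xi
    by (simp add: abs_mult mult.assoc flip: right_diff_distrib)
  moreover have "norm (?f1 x - ?f1 y) \<le> (L * \<xi>) * \<bar>x - y\<bar>" if "x \<in> cantor_set \<xi>" "y \<in> cantor_set \<xi>" for x y
    using Suc.prems(1)[OF cantor_set_affine(2)[OF that(1)] cantor_set_affine(2)[OF that(2)]] xi
    by (simp add: abs_mult mult.assoc flip: right_diff_distrib)
  ultimately have "norm (cantor_mean \<xi> (N + p) ?f0 - cantor_mean \<xi> N ?f0) \<le> L * \<xi> * \<xi> ^ N"
      "norm (cantor_mean \<xi> (N + p) ?f1 - cantor_mean \<xi> N ?f1) \<le> L * \<xi> * \<xi> ^ N"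
    using xi Suc.prems(2) by (auto intro!: Suc.IH)
  from norm_triangle_mono[OF this]
  have le: "norm ((cantor_mean \<xi> (N + p) ?f0 - cantor_mean \<xi> N ?f0) + (cantor_mean \<xi> (N + p) ?f1 - cantor_mean \<xi> N ?f1))
      \<le> 2 * (L * \<xi> * \<xi> ^ N)" by simp
  have "cantor_mean \<xi> (Suc N + p) f - cantor_mean \<xi> (Suc N) f = (1/2) *\<^sub>R
     ((cantor_mean \<xi> (N + p) ?f0 - cantor_mean \<xi> N ?f0) + (cantor_mean \<xi> (N + p) ?f1 - cantor_mean \<xi> N ?f1))"
    by (simp add: algebra_simps)
  then show ?case using le by (simp add: mult.assoc)
qed

text \<open>The limit plays the part of the integral against the Cantor measure. The explicit rate
  is what makes convergence locally uniform in a parameter.\<close>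

lemma mean_convergent:
  fixes f :: "real \<Rightarrow> complex"
  assumes "\<And>x y. x \<in> cantor_set \<xi> \<Longrightarrow> y \<in> cantor_set \<xi> \<Longrightarrow> norm (f x - f y) \<le> L * \<bar>x - y\<bar>" and "0 \<le> L"
  shows "(\<lambda>N. cantor_mean \<xi> N f) \<longlonglongrightarrow> lim (\<lambda>N. cantor_mean \<xi> N f)"
    and "norm (lim (\<lambda>N. cantor_mean \<xi> N f) - cantor_mean \<xi> N f) \<le> L * \<xi> ^ N"
proof -
  have "Cauchy (\<lambda>N. cantor_mean \<xi> N f)"
  proof (rule metric_CauchyI)
    fix e :: real assume e: "0 < e"
    have "(\<lambda>N. L * \<xi> ^ N) \<longlonglongrightarrow> 0" using xi by (auto intro!: tendsto_eq_intros LIMSEQ_realpow_zero)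
    then have "\<forall>\<^sub>F N in sequentially. L * \<xi> ^ N < e/2" using e by (intro order_tendstoD) auto
    then obtain N where N: "L * \<xi> ^ N < e/2" by (auto simp: eventually_sequentially)
    have "dist (cantor_mean \<xi> n f) (cantor_mean \<xi> N f) < e/2" if "n \<ge> N" for n
      using mean_Cauchy[OF assms, of N "n - N"] that N by (simp add: dist_norm)
    then show "\<exists>M. \<forall>m\<ge>M. \<forall>n\<ge>M. dist (cantor_mean \<xi> m f) (cantor_mean \<xi> n f) < e"
      using dist_triangle_half_l by blast
  qed
  then show lim: "(\<lambda>N. cantor_mean \<xi> N f) \<longlonglongrightarrow> lim (\<lambda>N. cantor_mean \<xi> N f)"
    using Cauchy_convergent_iff convergent_LIMSEQ_iff by blast
  show "norm (lim (\<lambda>N. cantor_mean \<xi> N f) - cantor_mean \<xi> N f) \<le> L * \<xi> ^ N"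
  proof (rule tendsto_upperbound)
    show "(\<lambda>p. norm (cantor_mean \<xi> (N + p) f - cantor_mean \<xi> N f)) \<longlonglongrightarrow>
        norm (lim (\<lambda>N. cantor_mean \<xi> N f) - cantor_mean \<xi> N f)"
      using LIMSEQ_ignore_initial_segment[OF lim, of N] by (intro tendsto_intros) (simp add: add.commute)
  qed (simp_all add: mean_Cauchy[OF assms])
qed

end

section \<open>The singular inner function of the Cantor measure\<close>

definition herglotz_kernel :: "complex \<Rightarrow> real \<Rightarrow> complex"
  where "herglotz_kernel z t = (circ t + z) / (circ t - z)"

text \<open>Separates radial from angular distance. The case \<open>r = 1\<close> gives chord
  lengths, \<open>r < 1\<close> the denominator of the Poisson kernel.\<close>

lemma norm_circ_diff_sq:
  "(cmod (circ t - of_real r * circ \<theta>))\<^sup>2 = (1 - r)\<^sup>2 + 4 * r * (sin (pi * (t - \<theta>)))\<^sup>2"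
proof -
  have c: "2 * (sin (pi * (t - \<theta>)))\<^sup>2 = 1 - cos (2 * pi * t - 2 * pi * \<theta>)"
    using cos_double_sin[of "pi * (t - \<theta>)"] by (simp add: algebra_simps)
  have "(cmod (circ t - of_real r * circ \<theta>))\<^sup>2 =
      (cos (2 * pi * t) - r * cos (2 * pi * \<theta>))\<^sup>2 + (sin (2 * pi * t) - r * sin (2 * pi * \<theta>))\<^sup>2"
    unfolding cmod_power2 by (simp add: circ_def)
  also have "\<dots> = ((sin (2 * pi * t))\<^sup>2 + (cos (2 * pi * t))\<^sup>2) + r\<^sup>2 * ((sin (2 * pi * \<theta>))\<^sup>2 + (cos (2 * pi * \<theta>))\<^sup>2)
      - 2 * r * (cos (2 * pi * t) * cos (2 * pi * \<theta>) + sin (2 * pi * t) * sin (2 * pi * \<theta>))"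
    by (simp only: power2_eq_square) (simp only: algebra_simps)
  also have "\<dots> = 1 + r\<^sup>2 - 2 * r * cos (2 * pi * t - 2 * pi * \<theta>)"
    by (simp add: cos_diff)
  also have "\<dots> = (1 - r)\<^sup>2 + 2 * r * (2 * (sin (pi * (t - \<theta>)))\<^sup>2)"
    unfolding c by (simp add: power2_eq_square algebra_simps)
  finally show ?thesis by simp
qed

lemma norm_circ_diff: "cmod (circ x - circ y) \<le> 2 * pi * \<bar>x - y\<bar>"
proof -
  have "(cmod (circ x - circ y))\<^sup>2 = (2 * \<bar>sin (pi * (x - y))\<bar>)\<^sup>2"
    using norm_circ_diff_sq[of x 1 y] by (simp add: power_mult_distrib)
  then have "cmod (circ x - circ y) = 2 * \<bar>sin (pi * (x - y))\<bar>" by (rule power2_eq_imp_eq) auto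
  also have "\<dots> \<le> 2 * \<bar>pi * (x - y)\<bar>" by (intro mult_left_mono abs_sin_x_le_abs_x) auto
  finally show ?thesis by (simp add: abs_mult)
qed

text \<open>The right-hand side is the Poisson kernel.\<close>

lemma Re_herglotz_kernel: "Re (herglotz_kernel z t) = (1 - (cmod z)\<^sup>2) / (cmod (circ t - z))\<^sup>2"
proof -
  have "(Re (circ t) + Re z) * (Re (circ t) - Re z) + (Im (circ t) + Im z) * (Im (circ t) - Im z)
      = (cmod (circ t))\<^sup>2 - (cmod z)\<^sup>2"
    unfolding cmod_power2 by (simp add: power2_eq_square algebra_simps)
  then show ?thesis
    unfolding herglotz_kernel_def Re_divide cmod_power2[of "circ t - z"] by simp
qed

context cantor
begin

abbreviation E where "E \<equiv> circ ` cantor_set \<xi>"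

lemma compact_E: "compact E"
  by (intro compact_continuous_image compact_cantor_set continuous_intros)

lemma open_Compl_E: "open (- E)"
  using compact_imp_closed[OF compact_E] by (simp add: open_Compl)

lemma unit_disc_Compl_E: "ball 0 1 \<subseteq> - E"
  by auto

text \<open>Halving the radius of a disc that misses E gives one \<open>d\<close> that is both a
  radius and a distance to E valid for every centre \<open>w\<close>.\<close>

lemma away_from_E:
  assumes "z \<notin> E"
  obtains d where "0 < d" and "cball z d \<subseteq> - E"
    and "\<And>w t. w \<in> cball z d \<Longrightarrow> t \<in> cantor_set \<xi> \<Longrightarrow> d \<le> cmod (circ t - w)"
proof -
  obtain e where e: "0 < e" "ball z e \<subseteq> - E"
    using open_Compl_E assms by (meson ComplI open_contains_ball)
  have far: "e/2 \<le> cmod (circ t - w)" if "w \<in> cball z (e/2)" "t \<in> cantor_set \<xi>" for w t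
  proof -
    have "circ t \<notin> ball z e" using e that by blast
    then have "e \<le> cmod (z - circ t)" by (simp add: dist_norm)
    also have "\<dots> \<le> cmod (z - w) + cmod (circ t - w)"
      using norm_triangle_ineq4[of "z - w" "circ t - w"] by simp
    also have "cmod (z - w) \<le> e/2" using that by (simp add: dist_norm)
    finally show ?thesis by simp
  qed
  show ?thesis
    by (rule that[of "e/2"]) (use e far in \<open>auto simp: subset_iff\<close>)
qed

lemma kernel_lipschitz:
  assumes d: "0 < d" "\<And>t. t \<in> cantor_set \<xi> \<Longrightarrow> d \<le> cmod (circ t - z)"
    and xy: "x \<in> cantor_set \<xi>" "y \<in> cantor_set \<xi>"
  shows "cmod (herglotz_kernel z x - herglotz_kernel z y) \<le> 4 * pi * cmod z / d\<^sup>2 * \<bar>x - y\<bar>"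
proof -
  have nz: "circ x - z \<noteq> 0" "circ y - z \<noteq> 0" using d(1) d(2)[OF xy(1)] d(2)[OF xy(2)] by auto
  have "herglotz_kernel z x - herglotz_kernel z y = 2 * z * (circ y - circ x) / ((circ x - z) * (circ y - z))"
    unfolding herglotz_kernel_def using nz by (simp add: field_simps)
  then have "cmod (herglotz_kernel z x - herglotz_kernel z y)
      = 2 * cmod z * cmod (circ y - circ x) / (cmod (circ x - z) * cmod (circ y - z))"
    by (simp add: norm_mult norm_divide)
  also have "\<dots> \<le> 2 * cmod z * (2 * pi * \<bar>y - x\<bar>) / (d * d)"
    using d xy by (intro frac_le mult_mono norm_circ_diff) auto
  finally show ?thesis by (simp add: power2_eq_square abs_minus_commute mult_ac)
qed

definition H :: "complex \<Rightarrow> complex"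
  where "H z = lim (\<lambda>N. cantor_mean \<xi> N (herglotz_kernel z))"

lemma mean_tendsto_H:
  assumes "z \<notin> E"
  shows "(\<lambda>N. cantor_mean \<xi> N (herglotz_kernel z)) \<longlonglongrightarrow> H z"
proof -
  obtain d where d: "0 < d" "\<And>t. t \<in> cantor_set \<xi> \<Longrightarrow> d \<le> cmod (circ t - z)"
    using away_from_E[OF assms] by (metis centre_in_cball less_imp_le)
  show ?thesis
    unfolding H_def by (rule mean_convergent(1)[OF kernel_lipschitz[OF d]]) auto
qed

lemma holomorphic_H: "H holomorphic_on - E"
proof (rule holomorphic_uniform_sequence[OF open_Compl_E])
  show "(\<lambda>z. cantor_mean \<xi> N (herglotz_kernel z)) holomorphic_on - E" for N
    unfolding herglotz_kernel_def by (intro holomorphic_mean holomorphic_intros) auto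
  fix z assume "z \<in> - E"
  then obtain d where d: "0 < d" "cball z d \<subseteq> - E"
      "\<And>w t. w \<in> cball z d \<Longrightarrow> t \<in> cantor_set \<xi> \<Longrightarrow> d \<le> cmod (circ t - w)"
    using away_from_E[of z] by blast
  have "uniform_limit (cball z d) (\<lambda>N z. cantor_mean \<xi> N (herglotz_kernel z)) H sequentially"
  proof (rule uniform_limitI)
    fix e :: real assume "0 < e"
    \<comment> \<open>Dominates the Lipschitz constants from \<open>kernel_lipschitz\<close> for all
      points of the disc at once.\<close>
    define L where "L = 4 * pi * (cmod z + d) / d\<^sup>2"
    have "(\<lambda>N. L * \<xi> ^ N) \<longlonglongrightarrow> 0" using xi by (auto intro!: tendsto_eq_intros LIMSEQ_realpow_zero)
    then have ev: "\<forall>\<^sub>F N in sequentially. L * \<xi> ^ N < e" using \<open>0 < e\<close> by (intro order_tendstoD) auto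
    have bnd: "dist (cantor_mean \<xi> N (herglotz_kernel w)) (H w) \<le> L * \<xi> ^ N" if w: "w \<in> cball z d" for w N
    proof -
      have "cmod w \<le> cmod z + d" using w norm_triangle_ineq2[of w z] by (simp add: dist_norm norm_minus_commute)
      then have le: "4 * pi * cmod w / d\<^sup>2 \<le> L"
        unfolding L_def using d(1) by (intro divide_right_mono mult_left_mono) auto
      have "norm (H w - cantor_mean \<xi> N (herglotz_kernel w)) \<le> 4 * pi * cmod w / d\<^sup>2 * \<xi> ^ N"
        unfolding H_def by (rule mean_convergent(2)[OF kernel_lipschitz[OF d(1) d(3)[OF w]]]) auto
      also have "\<dots> \<le> L * \<xi> ^ N" using le xi by (intro mult_right_mono) auto
      finally show ?thesis by (simp add: dist_norm norm_minus_commute)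
    qed
    from ev show "\<forall>\<^sub>F N in sequentially. \<forall>w\<in>cball z d. dist (cantor_mean \<xi> N (herglotz_kernel w)) (H w) < e"
    proof (rule eventually_mono)
      fix N assume "L * \<xi> ^ N < e"
      then show "\<forall>w\<in>cball z d. dist (cantor_mean \<xi> N (herglotz_kernel w)) (H w) < e"
        using le_less_trans[OF bnd] by blast
    qed
  qed
  with d show "\<exists>d>0. cball z d \<subseteq> - E \<and>
      uniform_limit (cball z d) (\<lambda>N z. cantor_mean \<xi> N (herglotz_kernel z)) H sequentially" by blast
qed

text \<open>Bounds on averages become available only once the nodes resolve the distance of
  \<open>z\<close> from the circle; hence the threshold \<open>m\<close>.\<close>

lemma Re_H_le:
  assumes "z \<notin> E" and "\<And>N. N \<ge> m \<Longrightarrow> cantor_mean \<xi> N (\<lambda>t. Re (herglotz_kernel z t)) \<le> B"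
  shows "Re (H z) \<le> B"
proof (rule tendsto_upperbound[OF tendsto_Re[OF mean_tendsto_H[OF assms(1)]]])
  show "\<forall>\<^sub>F N in sequentially. Re (cantor_mean \<xi> N (herglotz_kernel z)) \<le> B"
    unfolding Re_mean eventually_sequentially using assms(2) by blast
qed simp

lemma Re_H_ge:
  assumes "z \<notin> E" and "\<And>N. N \<ge> m \<Longrightarrow> B \<le> cantor_mean \<xi> N (\<lambda>t. Re (herglotz_kernel z t))"
  shows "B \<le> Re (H z)"
proof (rule tendsto_lowerbound[OF tendsto_Re[OF mean_tendsto_H[OF assms(1)]]])
  show "\<forall>\<^sub>F N in sequentially. B \<le> Re (cantor_mean \<xi> N (herglotz_kernel z))"
    unfolding Re_mean eventually_sequentially using assms(2) by blast
qed simp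

lemma Re_H_nonneg:
  assumes z: "cmod z < 1"
  shows "0 \<le> Re (H z)"
proof (rule Re_H_ge)
  show "z \<notin> E" using z by auto
  have "0 \<le> Re (herglotz_kernel z t)" for t
    unfolding Re_herglotz_kernel using z by (intro divide_nonneg_nonneg) (auto simp: power_le_one)
  then show "0 \<le> cantor_mean \<xi> N (\<lambda>t. Re (herglotz_kernel z t))" for N
    using mean_mono[of "\<lambda>_. 0" "\<lambda>t. Re (herglotz_kernel z t)" N] by simp
qed

text \<open>Away from E the denominator of the Poisson kernel stays above \<open>d\<^sup>2\<close>,
  while its numerator tends to 0.\<close>

lemma Re_H_radial_limit:
  assumes "circ \<theta> \<notin> E" and r: "r \<longlonglongrightarrow> 1" "\<And>n. 0 \<le> r n" "\<And>n. r n < (1::real)"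
  shows "(\<lambda>n. Re (H (of_real (r n) * circ \<theta>))) \<longlonglongrightarrow> 0"
proof -
  obtain d where d: "0 < d" "\<And>w t. w \<in> cball (circ \<theta>) d \<Longrightarrow> t \<in> cantor_set \<xi> \<Longrightarrow> d \<le> cmod (circ t - w)"
    using away_from_E[OF assms(1)] by metis
  have n: "cmod (of_real (r n) * circ \<theta>) = r n" for n using r(2) by (simp add: norm_mult)
  have le: "Re (H (of_real (r n) * circ \<theta>)) \<le> (1 - (r n)\<^sup>2) / d\<^sup>2" if "1 - d < r n" for n
  proof (rule Re_H_le[where m = 0])
    let ?w = "of_real (r n) * circ \<theta>"
    show "?w \<notin> E" using n[of n] r(3)[of n] by auto
    have "cmod (circ \<theta> - ?w) = 1 - r n"
      using norm_mult[of "of_real (1 - r n)" "circ \<theta>"] r(3)[of n] norm_of_real[of "1 - r n", where 'a = complex]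
      by (simp add: left_diff_distrib)
    then have "?w \<in> cball (circ \<theta>) d" using that by (simp add: dist_norm)
    from d(2)[OF this] have "Re (herglotz_kernel ?w t) \<le> (1 - (r n)\<^sup>2) / d\<^sup>2" if "t \<in> cantor_set \<xi>" for t
      unfolding Re_herglotz_kernel n using that d(1) r(2)[of n] r(3)[of n]
      by (intro frac_le power_mono) (auto simp: power_le_one)
    then show "cantor_mean \<xi> N (\<lambda>t. Re (herglotz_kernel ?w t)) \<le> (1 - (r n)\<^sup>2) / d\<^sup>2" for N
      using mean_mono[of "\<lambda>t. Re (herglotz_kernel ?w t)" "\<lambda>_. (1 - (r n)\<^sup>2) / d\<^sup>2" N] by simp
  qed
  show ?thesis
  proof (rule tendsto_sandwich)
    show "\<forall>\<^sub>F m in sequentially. 0 \<le> Re (H (of_real (r m) * circ \<theta>))"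
      using Re_H_nonneg n r(3) by (intro always_eventually allI) simp
    have "\<forall>\<^sub>F m in sequentially. 1 - d < r m" using r(1) d(1) by (intro order_tendstoD) auto
    then show "\<forall>\<^sub>F m in sequentially. Re (H (of_real (r m) * circ \<theta>)) \<le> (1 - (r m)\<^sup>2) / d\<^sup>2"
      by (rule eventually_mono) (rule le)
    show "(\<lambda>m. (1 - (r m)\<^sup>2) / d\<^sup>2) \<longlonglongrightarrow> 0"
      using r(1) d(1) by (auto intro!: tendsto_eq_intros)
  qed simp
qed

lemma negligible_bad_angles: "negligible {\<theta>\<in>{0..1}. circ \<theta> \<in> E}"
proof (rule negligible_subset)
  \<comment> \<open>Angles in [0,1] with the same image differ by an integer, so besides points of
    the Cantor set only the end points can occur.\<close>
  show "negligible (insert 0 (insert 1 (cantor_set \<xi>)))" using negligible_cantor_set by simp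
  show "{\<theta>\<in>{0..1}. circ \<theta> \<in> E} \<subseteq> insert 0 (insert 1 (cantor_set \<xi>))"
  proof
    fix \<theta> assume "\<theta> \<in> {\<theta>\<in>{0..1}. circ \<theta> \<in> E}"
    then obtain t where \<theta>: "\<theta> \<in> {0..1}" and t: "t \<in> cantor_set \<xi>" and eq: "circ \<theta> = circ t" by auto
    have t01: "t \<in> {0..1}" using t cantor_set_unit by blast
    have "sin (pi * (\<theta> - t)) = 0" using norm_circ_diff_sq[of \<theta> 1 t] eq by simp
    then obtain i :: int where "pi * (\<theta> - t) = of_int i * pi" by (auto simp: sin_zero_iff_int2)
    then have i: "\<theta> - t = of_int i" by simp
    then have "\<bar>real_of_int i\<bar> \<le> 1" using \<theta> t01 by (simp flip: i) (auto simp: abs_le_iff)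
    then have "i \<in> {-1, 0, 1}" by auto
    then show "\<theta> \<in> insert 0 (insert 1 (cantor_set \<xi>))" using i \<theta> t01 t by auto
  qed
qed

section \<open>The inner function and the spectrum of its model operator\<close>

definition S :: "real \<Rightarrow> complex \<Rightarrow> complex"
  where "S \<kappa> z = exp (- of_real \<kappa> * H z)"

lemma holomorphic_S: "S \<kappa> holomorphic_on - E"
  unfolding S_def by (intro holomorphic_intros holomorphic_H)

lemma norm_S: "cmod (S \<kappa> z) = exp (- \<kappa> * Re (H z))"
  by (simp add: S_def)

lemma norm_S_le_1: "0 \<le> \<kappa> \<Longrightarrow> cmod z < 1 \<Longrightarrow> cmod (S \<kappa> z) \<le> 1"
  using Re_H_nonneg by (simp add: norm_S)

text \<open>Means of |S|^2 over circles tend to 1 by dominated convergence, since |S| has radial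
  limit 1 off a null set; Parseval bounds these means by the squared norm.\<close>

lemma l2norm_S:
  assumes s: "power_series s (S \<kappa>)" and \<kappa>: "0 \<le> \<kappa>"
  shows "l2norm s = 1"
proof -
  have m: "multiplier s 1" using s norm_S_le_1[OF \<kappa>] by (auto simp: multiplier_def)
  define r where "r n = 1 - inverse (real (Suc n))" for n
  have r: "r \<longlonglongrightarrow> 1" "0 \<le> r n" "r n < 1" for n
    unfolding r_def[abs_def] using tendsto_diff[OF tendsto_const LIMSEQ_inverse_real_of_nat, of 1]
    by (auto simp: field_simps)
  define bad where "bad = {\<theta>\<in>{0..1}. circ \<theta> \<in> E}"
  \<comment> \<open>Overwriting the null set of bad angles by 1 makes the convergence hold at every
    point and leaves the integrals unchanged.\<close>
  define f where "f n t = (if t \<in> bad then 1 else (cmod (S \<kappa> (of_real (r n) * circ t)))\<^sup>2)" for n t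
  have int: "(f n has_integral (\<Sum>k. (cmod (s k))\<^sup>2 * r n ^ (2 * k))) {0..1}" for n
    by (rule has_integral_spike[OF negligible_bad_angles _ parseval(2)[OF s r(2,3)]])
      (auto simp: f_def bad_def)
  have "(\<lambda>n. integral {0..1} (f n)) \<longlonglongrightarrow> integral {0..1} (\<lambda>_::real. 1::real)"
  proof (rule dominated_convergence(2))
    show "f n integrable_on {0..1}" for n using int by blast
    show "(\<lambda>_::real. 1::real) integrable_on {0..1}" by (intro integrable_continuous_interval continuous_intros)
    show "norm (f n t) \<le> 1" for n t
      using norm_S_le_1[OF \<kappa>, of "of_real (r n) * circ t"] r(2,3)[of n]
      by (simp add: f_def norm_mult power_le_one)
    fix t :: real assume t: "t \<in> {0..1}"
    show "(\<lambda>n. f n t) \<longlonglongrightarrow> 1"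
    proof (cases "t \<in> bad")
      case False
      then have "circ t \<notin> E" using t by (simp add: bad_def)
      from Re_H_radial_limit[OF this r]
      have "(\<lambda>n. (exp (- \<kappa> * Re (H (of_real (r n) * circ t))))\<^sup>2) \<longlonglongrightarrow> (exp (- \<kappa> * 0))\<^sup>2"
        by (intro tendsto_intros)
      then show ?thesis using False by (simp add: f_def norm_S)
    qed (simp add: f_def)
  qed
  moreover have "integral {0..1} (f n) \<le> (l2norm s)\<^sup>2" for n
    using parseval_le_l2norm[OF s r(2,3) multiplier_l2(1)[OF m]] integral_unique[OF int] by simp
  ultimately have "1 \<le> (l2norm s)\<^sup>2"
    by (intro tendsto_upperbound[of "\<lambda>n. integral {0..1} (f n)" _ sequentially]) auto
  then have "1 \<le> l2norm s" using multiplier_l2(1)[OF m] power2_le_imp_le[of 1 "l2norm s"] by simp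
  then show ?thesis using multiplier_l2(2)[OF m] by simp
qed

lemma inner_model_S:
  assumes "0 \<le> \<kappa>"
  obtains s c where "inner_model s c (S \<kappa>) (\<lambda>z. inverse (S \<kappa> z))"
proof -
  have hol: "S \<kappa> holomorphic_on ball 0 1"
    by (rule holomorphic_on_subset[OF holomorphic_S unit_disc_Compl_E])
  obtain s where s: "power_series s (S \<kappa>)" using power_series_exists[OF hol] .
  have "(\<lambda>z. inverse (S \<kappa> z)) holomorphic_on ball 0 1"
    by (intro holomorphic_intros hol) (simp add: S_def)
  then obtain c where c: "power_series c (\<lambda>z. inverse (S \<kappa> z))" using power_series_exists by blast
  have "inner_model s c (S \<kappa>) (\<lambda>z. inverse (S \<kappa> z))"
    by unfold_locales (use s c norm_S_le_1[OF assms] l2norm_S[OF s assms] in \<open>auto simp: S_def\<close>)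
  then show ?thesis by (rule that)
qed

lemma spectrum_subset_E:
  assumes im: "inner_model s c (S \<kappa>) C" and \<kappa>: "0 \<le> \<kappa>"
  shows "complex_inner_space.spectrum l2_scale_op (model_space s) l2_ip bshift \<subseteq> E"
proof
  interpret inner_model s c "S \<kappa>" C by (rule im)
  fix \<mu> assume spec: "\<mu> \<in> spectrum bshift"
  show "\<mu> \<in> E"
  proof (rule ccontr)
    assume mu: "\<mu> \<notin> E"
    have nz: "S \<kappa> \<mu> \<noteq> 0" by (simp add: S_def)
    \<comment> \<open>The divided difference, completed at \<mu> by the derivative, is holomorphic
      off E; this also covers \<mu> inside the disc.\<close>
    define Q where "Q z = (if z = \<mu> then deriv (S \<kappa>) \<mu> else (S \<kappa> z - S \<kappa> \<mu>) / (z - \<mu>))" for z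
    define U where "U z = - Q z / S \<kappa> \<mu>" for z
    have Q: "Q holomorphic_on - E"
      unfolding Q_def[abs_def] by (rule pole_lemma_open[OF holomorphic_S open_Compl_E])
    obtain d where d: "0 < d" "cball \<mu> d \<subseteq> - E" using away_from_E[OF mu] by metis
    have "compact (Q ` cball \<mu> d)"
      using holomorphic_on_imp_continuous_on[OF holomorphic_on_subset[OF Q d(2)]]
      by (intro compact_continuous_image) auto
    then obtain K where K: "\<And>z. z \<in> cball \<mu> d \<Longrightarrow> cmod (Q z) \<le> K"
      using compact_imp_bounded by (force simp: bounded_iff)
    \<comment> \<open>Within \<open>d\<close> of \<mu> compactness gives \<open>K\<close>; farther
      away, |S| \<le> 1 on the disc gives the other term.\<close>
    define B where "B = max K ((1 + cmod (S \<kappa> \<mu>)) / d)"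
    have QB: "cmod (Q z) \<le> B" if z: "cmod z < 1" for z
    proof (cases "z \<in> cball \<mu> d")
      case True
      then show ?thesis using K[OF True] by (simp add: B_def le_max_iff_disj)
    next
      case False
      then have dz: "d \<le> cmod (z - \<mu>)" "z \<noteq> \<mu>" using d(1) by (auto simp: dist_norm norm_minus_commute)
      then have "cmod (Q z) = cmod (S \<kappa> z - S \<kappa> \<mu>) / cmod (z - \<mu>)" by (simp add: Q_def norm_divide)
      also have "\<dots> \<le> (1 + cmod (S \<kappa> \<mu>)) / d"
        using dz d(1) norm_S_le_1[OF \<kappa> z] norm_triangle_ineq4[of "S \<kappa> z" "S \<kappa> \<mu>"]
        by (intro frac_le) auto
      finally show ?thesis by (simp add: B_def)
    qed
    have B0: "0 \<le> B" using QB[of 0] order_trans[OF norm_ge_zero] by auto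
    have "U holomorphic_on ball 0 1"
      unfolding U_def using nz by (intro holomorphic_intros holomorphic_on_subset[OF Q unit_disc_Compl_E]) auto
    then obtain u where u: "power_series u U" using power_series_exists by blast
    have "multiplier u (B / cmod (S \<kappa> \<mu>))"
      unfolding multiplier_def using u QB B0
      by (auto simp: U_def norm_divide intro!: divide_right_mono exI[of _ U])
    moreover have "(z - \<mu>) * U z = 1 - (1 / S \<kappa> \<mu>) * S \<kappa> z" if "cmod z < 1" for z
      using nz by (auto simp: U_def Q_def field_simps)
    ultimately show False using notin_spectrum_bshift[OF _ u] spec by blast
  qed
qed

end

section \<open>Growth of the Herglotz transform near the Cantor set\<close>

text \<open>The cubic Taylor bound leaves x - x^3/6 \<ge> x/3 on this range. It will be used at pi v
  with |v| \<le> 1/2, where pi/3 \<ge> 1 removes the factor 3.\<close>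

lemma sin_ge_third:
  fixes x :: real
  assumes "0 \<le> x" "x \<le> 2"
  shows "x / 3 \<le> sin x"
proof -
  have "\<bar>sin x - (\<Sum>m<3. sin_coeff m * x ^ m)\<bar> \<le> inverse (fact 3) * \<bar>x\<bar> ^ 3"
    by (rule Maclaurin_sin_bound)
  then have "\<bar>sin x - x\<bar> \<le> x ^ 3 / 6"
    using assms by (simp add: sin_coeff_def lessThan_nat_numeral lessThan_Suc fact_numeral field_simps)
  moreover have "x ^ 3 \<le> 4 * x"
    using mult_right_mono[OF mult_mono[OF assms(2) assms(2)], of x] assms by (simp add: power3_eq_cube)
  ultimately show ?thesis by linarith
qed

text \<open>Distance on the circle is distance to the nearest lift of \<theta>, and the square of
  the sine does not see the integer shift. The coefficient \<open>4 * r\<close> of the angular term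
  is at least 1.\<close>

lemma norm_circ_diff_sq_ge:
  assumes r: "1/2 \<le> r" and u: "\<bar>t - \<theta>\<bar> \<le> 1"
  obtains i :: int where "i \<in> {-1, 0, 1}"
    and "(1 - r)\<^sup>2 + (t - (\<theta> + of_int i))\<^sup>2 \<le> (cmod (circ t - of_real r * circ \<theta>))\<^sup>2"
proof -
  have main: "(1 - r)\<^sup>2 + (t - (\<theta> + of_int i))\<^sup>2 \<le> (cmod (circ t - of_real r * circ \<theta>))\<^sup>2"
    if i: "\<bar>t - (\<theta> + of_int i)\<bar> \<le> 1/2" for i :: int
  proof -
    define v where "v = t - (\<theta> + of_int i)"
    have "pi * \<bar>v\<bar> \<le> 4 * (1/2)" using i pi_less_4 by (intro mult_mono) (auto simp: v_def)
    then have "\<bar>v\<bar> \<le> sin (pi * \<bar>v\<bar>)"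
      using sin_ge_third[of "pi * \<bar>v\<bar>"] mult_right_mono[of 3 pi "\<bar>v\<bar>"] pi_gt3 by simp
    then have "v\<^sup>2 \<le> (sin (pi * \<bar>v\<bar>))\<^sup>2" by (metis abs_ge_zero power2_abs power_mono)
    also have "\<dots> = (sin (pi * v))\<^sup>2" by (cases "0 \<le> v") auto
    also have "\<dots> = (sin (pi * (t - \<theta>)))\<^sup>2"
    proof -
      have s0: "sin (pi * of_int i) = 0" by simp
      have "pi * v = pi * (t - \<theta>) - pi * of_int i" by (simp add: v_def algebra_simps)
      then have "sin (pi * v) = sin (pi * (t - \<theta>)) * cos (pi * of_int i)"
        by (simp add: sin_diff s0)
      moreover have "(cos (pi * of_int i))\<^sup>2 = 1" unfolding cos_squared_eq s0 by simp
      ultimately show ?thesis by (simp add: power_mult_distrib)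
    qed
    also have "\<dots> \<le> 4 * r * \<dots>"
      using r mult_right_mono[of 1 "4 * r" "(sin (pi * (t - \<theta>)))\<^sup>2"] by simp
    finally show ?thesis unfolding norm_circ_diff_sq v_def by simp
  qed
  consider "\<bar>t - \<theta>\<bar> \<le> 1/2" | "t - \<theta> > 1/2" | "t - \<theta> < -1/2" by linarith
  then show ?thesis
  proof cases
    case 1 then show ?thesis using that[of 0] main[of 0] by simp
  next
    case 2 then show ?thesis using that[of 1] main[of 1] u by simp
  next
    case 3 then show ?thesis using that[of "-1"] main[of "-1"] u by simp
  qed
qed

context cantor
begin

text \<open>The Hausdorff dimension of the Cantor set.\<close>

definition \<alpha> :: real
  where "\<alpha> = ln 2 / ln (1 / \<xi>)"

lemma alpha: "0 < \<alpha>" "\<alpha> < 1" "\<xi> powr \<alpha> = 1/2"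
proof -
  have l: "ln 2 < ln (1 / \<xi>)" using xi by (simp add: field_simps)
  then have l0: "0 < ln (1 / \<xi>)" using ln_gt_zero[of "2::real"] by linarith
  show "0 < \<alpha>" "\<alpha> < 1"
    unfolding \<alpha>_def using l l0 by (simp_all only: divide_less_eq_1_pos) (simp add: divide_pos_pos)
  have "\<alpha> * ln \<xi> = - ln 2" using l0 xi by (simp add: \<alpha>_def ln_div)
  then show "\<xi> powr \<alpha> = 1/2" using xi by (simp add: powr_def exp_minus)
qed

lemma b_exponent_eq: "b_exponent \<xi> = (1 - \<alpha>) / (2 - \<alpha>)"
proof -
  have "ln 2 < ln (1 / \<xi>)" using xi by (simp add: field_simps)
  then have "ln (1 / \<xi>) > 0" by (meson less_trans ln_gt_zero one_less_numeral_iff semiring_norm(76))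
  then show ?thesis by (simp add: b_exponent_def \<alpha>_def divide_simps)
qed

lemma b_exponent_bounds: "0 < b_exponent \<xi>" "b_exponent \<xi> < 1"
  unfolding b_exponent_eq using alpha by (auto simp: field_simps)

text \<open>An interval of level \<open>K\<close> has mass 2^-K and length \<xi>^K; this is the
  quotient of the two.\<close>

lemma powr_level: "(\<xi> ^ K) powr (\<alpha> - 1) = 1 / (2 * \<xi>) ^ K"
proof -
  have "(\<xi> ^ K) powr (\<alpha> - 1) = (\<xi> powr (\<alpha> - 1)) ^ K"
    using xi by (simp add: powr_powr mult.commute flip: powr_realpow)
  also have "\<xi> powr (\<alpha> - 1) = 1 / (2 * \<xi>)" using xi by (simp add: powr_diff alpha(3))
  finally show ?thesis by (simp add: power_divide power_mult_distrib)
qed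

text \<open>By self-similarity the bound for radius \<open>\<delta>/\<xi>\<close> gives the one for \<open>\<delta>\<close>, because only one of the two
  halves of the Cantor set is close to \<open>\<theta>\<close>. The subtracted constant absorbs the other half.\<close>

lemma mean_inverse_square_le:
  obtains D where "0 < D"
    and "\<And>N \<delta> \<theta>. \<xi> ^ N \<le> \<delta> \<Longrightarrow> \<delta> \<le> 1 \<Longrightarrow>
      cantor_mean \<xi> N (\<lambda>t. 1 / (\<delta>\<^sup>2 + (t - \<theta>)\<^sup>2)) \<le> D * \<delta> powr (\<alpha> - 2)"
proof -
  \<comment> \<open>Bounds the integrand on the half that is far from \<theta>: each half stays at
    distance at least 1/2 - \<xi> from the midpoint 1/2.\<close>
  define Q where "Q = 1 / (1/2 - \<xi>)\<^sup>2"
  \<comment> \<open>Makes the bound at \<open>\<delta> = 1\<close>, after subtraction of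
    \<open>Q / 2\<close>, equal to the trivial bound \<open>1 / \<xi>\<^sup>2\<close> valid for
    \<delta> \<ge> \<xi>.\<close>
  define D where "D = 1 / \<xi>\<^sup>2 + Q / 2"
  have Q: "0 \<le> Q" by (simp add: Q_def)
  have D: "0 < D" using xi Q by (simp add: D_def add_pos_nonneg)
  have big: "cantor_mean \<xi> N (\<lambda>t. 1 / (\<delta>\<^sup>2 + (t - \<theta>)\<^sup>2)) \<le> D * \<delta> powr (\<alpha> - 2) - Q / 2"
    if "\<xi> \<le> \<delta>" "\<delta> \<le> 1" for N \<delta> \<theta>
  proof -
    have "1 / (\<delta>\<^sup>2 + (t - \<theta>)\<^sup>2) \<le> 1 / \<xi>\<^sup>2" for t
      using that xi power_mono[of \<xi> \<delta> 2] by (intro frac_le) (auto intro: add_increasing2)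
    then have "cantor_mean \<xi> N (\<lambda>t. 1 / (\<delta>\<^sup>2 + (t - \<theta>)\<^sup>2)) \<le> 1 / \<xi>\<^sup>2"
      using mean_mono[of "\<lambda>t. 1 / (\<delta>\<^sup>2 + (t - \<theta>)\<^sup>2)" "\<lambda>_. 1 / \<xi>\<^sup>2"] by simp
    also have "\<dots> = D * 1 - Q / 2" by (simp add: D_def)
    also have "\<dots> \<le> D * \<delta> powr (\<alpha> - 2) - Q / 2"
      using D that xi alpha powr_mono2'[of "2 - \<alpha>" \<delta> 1] powr_mono'[of "\<alpha> - 2" 0 \<delta>]
      by (intro diff_right_mono mult_left_mono) auto
    finally show ?thesis .
  qed
  have refined: "cantor_mean \<xi> N (\<lambda>t. 1 / (\<delta>\<^sup>2 + (t - \<theta>)\<^sup>2)) \<le> D * \<delta> powr (\<alpha> - 2) - Q / 2"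
    if "\<xi> ^ N \<le> \<delta>" "\<delta> \<le> 1" for N \<delta> \<theta>
    using that
  proof (induction N arbitrary: \<delta> \<theta>)
    case 0
    then show ?case using big[of \<delta> 0 \<theta>] xi by simp
  next
    case (Suc N)
    show ?case
    proof (cases "\<xi> \<le> \<delta>")
      case True
      then show ?thesis using big Suc.prems by blast
    next
      case False
      have dpos: "0 < \<delta>" using Suc.prems(1) xi by (meson less_le_trans zero_less_power)
      define X where "X = 2 * D * \<delta> powr (\<alpha> - 2) - Q / (2 * \<xi>\<^sup>2)"
      define f where "f a t = 1 / (\<delta>\<^sup>2 + (\<xi> * t + a - \<theta>)\<^sup>2)" for a t
      have near: "cantor_mean \<xi> N (f a) \<le> X" for a
      proof -
        have "f a t = (1 / \<xi>\<^sup>2) * (1 / ((\<delta> / \<xi>)\<^sup>2 + (t - (\<theta> - a) / \<xi>)\<^sup>2))" for t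
        proof -
          have "\<xi>\<^sup>2 * ((\<delta> / \<xi>)\<^sup>2 + (t - (\<theta> - a) / \<xi>)\<^sup>2) = (\<xi> * (\<delta> / \<xi>))\<^sup>2 + (\<xi> * (t - (\<theta> - a) / \<xi>))\<^sup>2"
            by (simp only: power_mult_distrib distrib_left)
          also have "\<xi> * (t - (\<theta> - a) / \<xi>) = \<xi> * t + a - \<theta>" using xi by (simp add: field_simps)
          also have "\<xi> * (\<delta> / \<xi>) = \<delta>" using xi by simp
          finally show ?thesis by (simp add: f_def)
        qed
        then have "f a = (\<lambda>t. (1 / \<xi>\<^sup>2) * (1 / ((\<delta> / \<xi>)\<^sup>2 + (t - (\<theta> - a) / \<xi>)\<^sup>2)))" by (rule ext)
        then have "cantor_mean \<xi> N (f a) = (1 / \<xi>\<^sup>2) * cantor_mean \<xi> N (\<lambda>t. 1 / ((\<delta> / \<xi>)\<^sup>2 + (t - (\<theta> - a) / \<xi>)\<^sup>2))"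
          by (simp only: mean_scale)
        also have "\<dots> \<le> (1 / \<xi>\<^sup>2) * (D * (\<delta> / \<xi>) powr (\<alpha> - 2) - Q / 2)"
          using Suc.prems(1) False xi by (intro mult_left_mono Suc.IH) (auto simp: field_simps)
        \<comment> \<open>Together with the scaling factor \<open>1 / \<xi>\<^sup>2\<close> this
          doubles the main term, and averaging over the two halves divides it by 2 again.\<close>
        also have "(\<delta> / \<xi>) powr (\<alpha> - 2) = \<delta> powr (\<alpha> - 2) * (2 * \<xi>\<^sup>2)"
          using dpos xi by (simp add: powr_divide powr_diff alpha(3))
        also have "(1 / \<xi>\<^sup>2) * (D * (\<delta> powr (\<alpha> - 2) * (2 * \<xi>\<^sup>2)) - Q / 2) = X"
          using xi by (simp add: X_def field_simps)
        finally show ?thesis .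
      qed
      have far: "cantor_mean \<xi> N (f a) \<le> Q" if a: "\<And>t. t \<in> {0..1} \<Longrightarrow> 1/2 - \<xi> \<le> \<bar>\<xi> * t + a - \<theta>\<bar>" for a
      proof -
        have "f a t \<le> Q" if "t \<in> cantor_set \<xi>" for t
        proof -
          have "(1/2 - \<xi>)\<^sup>2 \<le> \<bar>\<xi> * t + a - \<theta>\<bar>\<^sup>2"
            using a[of t] that cantor_set_unit xi by (intro power_mono) auto
          then show ?thesis
            unfolding f_def Q_def using xi by (intro frac_le) (auto intro: add_increasing)
        qed
        from mean_mono[of "f a" "\<lambda>_. Q", OF this] show ?thesis by simp
      qed
      have "cantor_mean \<xi> N (f 0) \<le> Q \<or> cantor_mean \<xi> N (f (1 - \<xi>)) \<le> Q"
      proof (cases "\<theta> \<le> 1/2")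
        case True
        have "1/2 - \<xi> \<le> \<bar>\<xi> * t + (1 - \<xi>) - \<theta>\<bar>" if "t \<in> {0..1}" for t
        proof -
          have "0 \<le> \<xi> * t" using that xi by simp
          then show ?thesis using True by linarith
        qed
        then show ?thesis using far by blast
      next
        case False
        have "1/2 - \<xi> \<le> \<bar>\<xi> * t + 0 - \<theta>\<bar>" if "t \<in> {0..1}" for t
        proof -
          have "\<xi> * t \<le> \<xi>" using that xi by (simp add: mult_left_le)
          then show ?thesis using False by linarith
        qed
        then show ?thesis using far by blast
      qed
      then have "cantor_mean \<xi> N (f 0) + cantor_mean \<xi> N (f (1 - \<xi>)) \<le> X + Q"
        using near[of 0] near[of "1 - \<xi>"] by linarith
      moreover have "cantor_mean \<xi> (Suc N) (\<lambda>t. 1 / (\<delta>\<^sup>2 + (t - \<theta>)\<^sup>2))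
          = (cantor_mean \<xi> N (f 0) + cantor_mean \<xi> N (f (1 - \<xi>))) / 2"
        by (simp add: f_def[abs_def])
      \<comment> \<open>The average of \<open>X\<close> and \<open>Q\<close> has constant term
        \<open>Q / 2 - Q / (4 * \<xi>\<^sup>2)\<close>, which is at most \<open>- Q / 2\<close>
        because 2 \<xi> \<le> 1.\<close>
      moreover have "Q * 2 \<le> Q / (2 * \<xi>\<^sup>2)"
      proof -
        have "\<xi>\<^sup>2 \<le> (1/2)\<^sup>2" using xi by (intro power_mono) auto
        then have "Q * (4 * \<xi>\<^sup>2) \<le> Q * 1" using Q by (intro mult_left_mono) (auto simp: power2_eq_square)
        then show ?thesis using xi by (simp add: field_simps)
      qed
      ultimately show ?thesis unfolding X_def by (simp add: field_simps)
    qed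
  qed
  show ?thesis
  proof (rule that[OF D])
    fix N \<delta> \<theta> assume "\<xi> ^ N \<le> \<delta>" "\<delta> \<le> 1"
    from refined[OF this, of \<theta>] Q
    show "cantor_mean \<xi> N (\<lambda>t. 1 / (\<delta>\<^sup>2 + (t - \<theta>)\<^sup>2)) \<le> D * \<delta> powr (\<alpha> - 2)" by linarith
  qed
qed

text \<open>Follow the left branch \<open>K\<close> times and discard every right branch: a share
  2^-K of the nodes lies in the leftmost interval.\<close>

lemma mean_ge_initial:
  fixes f :: "real \<Rightarrow> real"
  assumes "\<And>t. t \<in> cantor_set \<xi> \<Longrightarrow> 0 \<le> f t" and "\<And>t. t \<in> cantor_set \<xi> \<Longrightarrow> t \<le> \<xi> ^ K \<Longrightarrow> a \<le> f t"
    and "K \<le> N"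
  shows "a / 2 ^ K \<le> cantor_mean \<xi> N f"
  using assms
proof (induction K arbitrary: f N)
  case 0
  then show ?case using mean_mono[of "\<lambda>_. a" f N] cantor_set_unit by force
next
  case (Suc K)
  then obtain N' where N: "N = Suc N'" by (cases N) auto
  have "a / 2 ^ K \<le> cantor_mean \<xi> N' (\<lambda>t. f (\<xi> * t))"
  proof (rule Suc.IH)
    fix t assume "t \<in> cantor_set \<xi>" "t \<le> \<xi> ^ K"
    then show "a \<le> f (\<xi> * t)" using xi by (intro Suc.prems(2)) (auto simp: cantor_set_affine)
  qed (use Suc.prems N in \<open>auto simp: cantor_set_affine\<close>)
  moreover have "0 \<le> cantor_mean \<xi> N' (\<lambda>t. f (\<xi> * t + (1 - \<xi>)))"
    using mean_mono[of "\<lambda>_. 0" "\<lambda>t. f (\<xi> * t + (1 - \<xi>))" N'] Suc.prems(1) by (simp add: cantor_set_affine)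
  ultimately show ?case unfolding N by simp
qed

text \<open>Near the circle the Poisson kernel is at most 2 \<delta> times an inverse squared
  distance, which gains one power of \<delta> over \<open>mean_inverse_square_le\<close>. For |z| <
  1/2 the kernel is at most 4.\<close>

lemma Re_H_upper:
  obtains D where "0 < D" and "\<And>z. cmod z < 1 \<Longrightarrow> Re (H z) \<le> D * (1 - cmod z) powr (\<alpha> - 1)"
proof -
  obtain D where D: "0 < D" and mean: "\<And>N \<delta> \<theta>. \<xi> ^ N \<le> \<delta> \<Longrightarrow> \<delta> \<le> 1 \<Longrightarrow>
      cantor_mean \<xi> N (\<lambda>t. 1 / (\<delta>\<^sup>2 + (t - \<theta>)\<^sup>2)) \<le> D * \<delta> powr (\<alpha> - 2)"
    using mean_inverse_square_le by blast
  have "Re (H z) \<le> (6 * D + 4) * (1 - cmod z) powr (\<alpha> - 1)" if z: "cmod z < 1" for z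
  proof -
    define \<delta> where "\<delta> = 1 - cmod z"
    have \<delta>: "0 < \<delta>" "\<delta> \<le> 1" using z by (auto simp: \<delta>_def)
    have zE: "z \<notin> E" using z by auto
    have one: "1 - (cmod z)\<^sup>2 \<le> 2 * \<delta>"
      using zero_le_power2[of "1 - cmod z"] by (simp add: \<delta>_def power2_eq_square algebra_simps)
    show ?thesis
    proof (cases "cmod z < 1/2")
      case True
      have "Re (herglotz_kernel z t) \<le> 4" for t
      proof -
        have "1/2 \<le> cmod (circ t - z)" using norm_triangle_ineq2[of "circ t" z] True by simp
        then have "(1/2)\<^sup>2 \<le> (cmod (circ t - z))\<^sup>2" by (intro power_mono) auto
        then have "(1 - (cmod z)\<^sup>2) / (cmod (circ t - z))\<^sup>2 \<le> 1 / (1/2)\<^sup>2" by (intro frac_le) auto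
        then show ?thesis by (simp add: Re_herglotz_kernel power2_eq_square)
      qed
      then have "Re (H z) \<le> 4"
        using mean_mono[of "\<lambda>t. Re (herglotz_kernel z t)" "\<lambda>_. 4"] by (intro Re_H_le[OF zE, of 0]) simp
      also have "\<dots> \<le> (6 * D + 4) * 1" using D by simp
      also have "\<dots> \<le> (6 * D + 4) * \<delta> powr (\<alpha> - 1)"
        using D \<delta> alpha powr_mono'[of "\<alpha> - 1" 0 \<delta>] by (intro mult_left_mono) auto
      finally show ?thesis by (simp add: \<delta>_def)
    next
      case False
      define \<theta> where "\<theta> = Arg2pi z / (2 * pi)"
      have \<theta>: "0 \<le> \<theta>" "\<theta> \<le> 1"
        using Arg2pi_ge_0[of z] Arg2pi_lt_2pi[of z] by (auto simp: \<theta>_def)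
      have z_eq: "z = of_real (1 - \<delta>) * circ \<theta>"
        using Arg2pi_eq[of z] by (simp add: \<delta>_def \<theta>_def circ_def cis_conv_exp)
      \<comment> \<open>Which lift of \<theta> is nearest depends on \<open>t\<close>, so the three
        candidates are summed; hence the factor 3 below.\<close>
      define g where "g i t = 1 / (\<delta>\<^sup>2 + (t - (\<theta> + of_int i))\<^sup>2)" for i :: int and t
      have kern: "Re (herglotz_kernel z t) \<le> 2 * \<delta> * (g (-1) t + (g 0 t + g 1 t))" if t: "t \<in> cantor_set \<xi>" for t
      proof -
        have "\<bar>t - \<theta>\<bar> \<le> 1" using t cantor_set_unit \<theta> by (auto simp: abs_le_iff)
        moreover have "1/2 \<le> 1 - \<delta>" using False by (simp add: \<delta>_def)
        ultimately obtain i where i: "i \<in> {-1, 0, 1}"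
          and le: "\<delta>\<^sup>2 + (t - (\<theta> + of_int i))\<^sup>2 \<le> (cmod (circ t - z))\<^sup>2"
          using norm_circ_diff_sq_ge[of "1 - \<delta>" t \<theta>] z_eq by auto
        have "Re (herglotz_kernel z t) \<le> (2 * \<delta>) / (\<delta>\<^sup>2 + (t - (\<theta> + of_int i))\<^sup>2)"
          unfolding Re_herglotz_kernel using one le \<delta>
          by (intro frac_le) (auto intro: add_pos_nonneg)
        also have "\<dots> = 2 * \<delta> * g i t" by (simp add: g_def)
        also have "\<dots> \<le> 2 * \<delta> * (g (-1) t + (g 0 t + g 1 t))"
        proof -
          have "0 \<le> g j t" for j by (simp add: g_def)
          then have "g i t \<le> g (-1) t + (g 0 t + g 1 t)"
            using i by (auto intro: add_increasing add_increasing2 add_nonneg_nonneg)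
          then show ?thesis using \<delta> by (intro mult_left_mono) auto
        qed
        finally show ?thesis .
      qed
      have "(\<lambda>N. \<xi> ^ N) \<longlonglongrightarrow> 0" using xi by (intro LIMSEQ_realpow_zero) auto
      then have "\<forall>\<^sub>F N in sequentially. \<xi> ^ N < \<delta>" using \<delta> by (intro order_tendstoD) auto
      then obtain m where m: "\<And>N. N \<ge> m \<Longrightarrow> \<xi> ^ N < \<delta>" by (auto simp: eventually_sequentially)
      have "Re (H z) \<le> 2 * \<delta> * (3 * (D * \<delta> powr (\<alpha> - 2)))"
      proof (rule Re_H_le[OF zE])
        fix N assume N: "N \<ge> m"
        have g: "cantor_mean \<xi> N (g i) \<le> D * \<delta> powr (\<alpha> - 2)" for i
          unfolding g_def[abs_def] using m[OF N] \<delta> by (intro mean) auto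
        have "cantor_mean \<xi> N (\<lambda>t. Re (herglotz_kernel z t))
            \<le> cantor_mean \<xi> N (\<lambda>t. 2 * \<delta> * (g (-1) t + (g 0 t + g 1 t)))"
          by (rule mean_mono[OF kern])
        also have "\<dots> = 2 * \<delta> * (cantor_mean \<xi> N (g (-1)) + (cantor_mean \<xi> N (g 0) + cantor_mean \<xi> N (g 1)))"
          unfolding mean_scale mean_add ..
        also have "\<dots> \<le> 2 * \<delta> * (3 * (D * \<delta> powr (\<alpha> - 2)))"
          using g[of "-1"] g[of 0] g[of 1] \<delta> by (intro mult_left_mono) auto
        finally show "cantor_mean \<xi> N (\<lambda>t. Re (herglotz_kernel z t)) \<le> 2 * \<delta> * (3 * (D * \<delta> powr (\<alpha> - 2)))" .
      qed
      also have "\<dots> = 6 * D * \<delta> powr (\<alpha> - 1)"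
        using \<delta> powr_add[of \<delta> 1 "\<alpha> - 2"] by simp
      also have "\<dots> \<le> (6 * D + 4) * \<delta> powr (\<alpha> - 1)" by (intro mult_right_mono) auto
      finally show ?thesis by (simp add: \<delta>_def)
    qed
  qed
  then show ?thesis using that[of "6 * D + 4"] D by simp
qed

text \<open>With \<delta> = \<xi>^K, the leftmost interval of level \<open>K\<close> has mass 2^-K
  and is mapped within 2 pi \<delta> of 1, hence within (2 pi + 1) \<delta> of the point 1 -
  \<delta>; there the kernel is at least 1 / ((2 pi + 1)^2 \<delta>).\<close>

lemma Re_H_lower:
  assumes K: "0 < K"
  shows "(\<xi> ^ K) powr (\<alpha> - 1) / (2 * pi + 1)\<^sup>2 \<le> Re (H (of_real (1 - \<xi> ^ K)))"
proof -
  define \<delta> where "\<delta> = \<xi> ^ K"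
  have "\<xi> ^ K \<le> \<xi> ^ 1" using K xi by (intro power_decreasing) auto
  then have \<delta>: "0 < \<delta>" "\<delta> < 1" using xi by (auto simp: \<delta>_def)
  let ?z = "complex_of_real (1 - \<delta>)"
  have nz: "cmod ?z = 1 - \<delta>" using \<delta> by (simp del: of_real_diff)
  have "(1 / ((2 * pi + 1)\<^sup>2 * \<delta>)) / 2 ^ K \<le> Re (H ?z)"
  proof (rule Re_H_ge)
    have "cmod ?z \<noteq> 1" unfolding nz using \<delta> by simp
    then show "?z \<notin> E" by (metis (no_types, lifting) image_iff norm_circ)
    fix N assume N: "K \<le> N"
    show "(1 / ((2 * pi + 1)\<^sup>2 * \<delta>)) / 2 ^ K \<le> cantor_mean \<xi> N (\<lambda>t. Re (herglotz_kernel ?z t))"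
    proof (rule mean_ge_initial[OF _ _ N])
      show "0 \<le> Re (herglotz_kernel ?z t)" for t
        unfolding Re_herglotz_kernel nz using \<delta> by (intro divide_nonneg_nonneg) (auto simp: power_le_one)
      fix t assume t: "t \<in> cantor_set \<xi>" "t \<le> \<xi> ^ K"
      have t0: "0 \<le> t" using t(1) cantor_set_unit by auto
      have "cmod (circ t - ?z) = cmod ((circ t - circ 0) + of_real \<delta>)"
      proof -
        have "circ 0 = 1" by (simp add: circ_def)
        then show ?thesis by (simp add: algebra_simps)
      qed
      also have "\<dots> \<le> cmod (circ t - circ 0) + \<delta>"
        using norm_triangle_ineq[of "circ t - circ 0" "of_real \<delta>"] \<delta> by simp
      also have "\<dots> \<le> 2 * pi * \<delta> + \<delta>"
      proof -
        have "2 * pi * \<bar>t - 0\<bar> \<le> 2 * pi * \<delta>" using t(2) t0 by (simp add: \<delta>_def)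
        then show ?thesis using norm_circ_diff[of t 0] by linarith
      qed
      finally have up: "cmod (circ t - ?z) \<le> (2 * pi + 1) * \<delta>" by (simp add: algebra_simps)
      have low: "\<delta> \<le> 1 - (1 - \<delta>)\<^sup>2" using \<delta> by (simp add: power2_eq_square algebra_simps)
      have "0 < cmod (circ t - ?z)"
        using norm_triangle_ineq2[of "circ t" ?z] \<delta> unfolding nz norm_circ by linarith
      then have "\<delta> / ((2 * pi + 1) * \<delta>)\<^sup>2 \<le> Re (herglotz_kernel ?z t)"
        unfolding Re_herglotz_kernel nz using low up \<delta> by (intro frac_le power_mono) auto
      also have "\<delta> / ((2 * pi + 1) * \<delta>)\<^sup>2 = 1 / ((2 * pi + 1)\<^sup>2 * \<delta>)"
        using \<delta> by (simp add: power_mult_distrib power2_eq_square)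
      finally show "1 / ((2 * pi + 1)\<^sup>2 * \<delta>) \<le> Re (herglotz_kernel ?z t)" .
    qed
  qed
  then show ?thesis unfolding powr_level \<delta>_def by (simp add: power_mult_distrib mult_ac)
qed

end

section \<open>Taylor coefficients of the reciprocal of the inner function\<close>

text \<open>A Young-type inequality, split where x^(1 - \<beta>) = 2/\<delta>. It trades growth
  exp(n^\<beta>) for geometric growth exp(\<delta> n / 2) and a factor independent of n.\<close>

lemma powr_le_linear:
  fixes x \<delta> \<beta> :: real
  assumes x: "0 < x" and \<delta>: "0 < \<delta>" and \<beta>: "0 < \<beta>" "\<beta> < 1"
  shows "x powr \<beta> \<le> \<delta> / 2 * x + (2 / \<delta>) powr (\<beta> / (1 - \<beta>))"
proof (cases "2 / \<delta> \<le> x powr (1 - \<beta>)")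
  case True
  have "x powr \<beta> * (2 / \<delta>) \<le> x powr \<beta> * x powr (1 - \<beta>)" using True by (intro mult_left_mono) auto
  also have "\<dots> = x" using x by (simp flip: powr_add)
  finally have "x powr \<beta> \<le> \<delta> / 2 * x" using \<delta> by (simp add: field_simps)
  then show ?thesis by (rule order_trans) simp
next
  case False
  have "x powr \<beta> = (x powr (1 - \<beta>)) powr (\<beta> / (1 - \<beta>))" using \<beta> by (simp add: powr_powr)
  also have "\<dots> \<le> (2 / \<delta>) powr (\<beta> / (1 - \<beta>))" using False \<beta> by (intro powr_mono2) auto
  finally show ?thesis using x \<delta> by (intro add_increasing) auto
qed

context cantor
begin

text \<open>One radius, depending on \<open>n\<close>, serves all \<open>k < n\<close>, which is the
  range of the sum in \<open>opnorm_inv_pow_le\<close>.\<close>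

lemma coeff_upper:
  assumes D: "0 < D" "\<And>z. cmod z < 1 \<Longrightarrow> Re (H z) \<le> D * (1 - cmod z) powr (\<alpha> - 1)"
    and \<kappa>: "\<kappa> = (1/16) powr (1 - \<alpha>) / (8 * D)"
    and c: "power_series c (\<lambda>z. inverse (S \<kappa> z))"
    and kn: "k < n"
  shows "cmod (c k) \<le> exp (real n powr b_exponent \<xi> / 4)"
proof -
  define b where "b = b_exponent \<xi>"
  have n: "1 \<le> real n" using kn by simp
  \<comment> \<open>This power balances n \<delta> against \<delta>^(\<alpha> - 1), both being of
    order n^b. With 1/16 and the given \<kappa>, the factors r^-k and sup |1/S| are each at most
    exp(n^b / 8).\<close>
  define \<delta> where "\<delta> = (1/16) * real n powr (- 1 / (2 - \<alpha>))"
  define r where "r = 1 - \<delta>"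
  have "real n powr (- 1 / (2 - \<alpha>)) \<le> real n powr 0" using n alpha by (intro powr_mono) (auto simp: field_simps)
  then have \<delta>: "0 < \<delta>" "\<delta> \<le> 1/16" using n by (auto simp: \<delta>_def)
  then have r: "0 < r" "r < 1" by (auto simp: r_def)
  have b1: "- 1 / (2 - \<alpha>) + 1 = b" "- 1 / (2 - \<alpha>) * (\<alpha> - 1) = b"
    unfolding b_def b_exponent_eq using alpha by (simp_all add: field_simps)
  have n\<delta>: "real n * \<delta> = real n powr b / 16"
    using n powr_add[of "real n" "- 1 / (2 - \<alpha>)" 1] unfolding b1(1) by (simp add: \<delta>_def)
  have \<kappa>\<delta>: "\<kappa> * (D * \<delta> powr (\<alpha> - 1)) = real n powr b / 8"
  proof -
    have "\<delta> powr (\<alpha> - 1) = (1/16) powr (\<alpha> - 1) * real n powr b"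
      unfolding \<delta>_def by (simp only: powr_mult powr_powr b1(2))
    moreover have "(1/16) powr (1 - \<alpha>) * (1/16) powr (\<alpha> - 1) = (1::real)" by (simp flip: powr_add)
    ultimately have "\<kappa> * (D * \<delta> powr (\<alpha> - 1)) =
        (1/16) powr (1 - \<alpha>) * (1/16) powr (\<alpha> - 1) * real n powr b / 8"
      using D(1) by (simp add: \<kappa>)
    then show ?thesis using \<open>(1/16) powr (1 - \<alpha>) * (1/16) powr (\<alpha> - 1) = (1::real)\<close> by simp
  qed
  have \<kappa>0: "0 \<le> \<kappa>" using D(1) by (simp add: \<kappa>)
  have "cmod (c k) * r ^ k \<le> exp (real n powr b / 8)"
  proof (rule power_series_coeff_bound[OF c])
    fix z assume z: "cmod z = r"
    have "cmod (inverse (S \<kappa> z)) = exp (\<kappa> * Re (H z))"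
      by (simp add: norm_inverse norm_S flip: exp_minus)
    also have "\<kappa> * Re (H z) \<le> \<kappa> * (D * \<delta> powr (\<alpha> - 1))"
      using D(2)[of z] z r \<kappa>0 by (intro mult_left_mono) (auto simp: r_def)
    finally show "cmod (inverse (S \<kappa> z)) \<le> exp (real n powr b / 8)" by (simp add: \<kappa>\<delta>)
  qed (use r in auto)
  moreover have "exp (- (real n powr b / 8)) \<le> r ^ k"
  proof -
    \<comment> \<open>The product is 1 + \<delta> (1 - 2 \<delta>); it leads to 1 - \<delta> \<ge>
      exp(-2 \<delta>).\<close>
    have "1 \<le> (1 + 2 * \<delta>) * r" using \<delta> by (simp add: r_def algebra_simps mult_left_le)
    also have "\<dots> \<le> exp (2 * \<delta>) * r" using r by (intro mult_right_mono exp_ge_add_one_self) auto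
    finally have "exp (- (2 * \<delta>)) \<le> r" by (simp add: exp_minus field_simps)
    then have "exp (- (2 * \<delta>)) ^ n \<le> r ^ n" by (intro power_mono) auto
    also have "\<dots> \<le> r ^ k" using r kn by (intro power_decreasing) auto
    finally have "exp (- (2 * (real n * \<delta>))) \<le> r ^ k" by (simp add: mult_ac flip: exp_of_nat_mult)
    then show ?thesis unfolding n\<delta> by simp
  qed
  then have "cmod (c k) * exp (- (real n powr b / 8)) \<le> cmod (c k) * r ^ k" by (intro mult_left_mono) auto
  ultimately have "cmod (c k) * exp (- (real n powr b / 8)) \<le> exp (real n powr b / 8)" by linarith
  then have "cmod (c k) \<le> exp (real n powr b / 8) * exp (real n powr b / 8)"
    by (simp add: exp_minus field_simps)
  then show ?thesis by (simp add: b_def flip: exp_add)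
qed

text \<open>Otherwise, summing the series at 1 - \<delta> bounds ln |1/S| there by order
  (1/\<delta>)^p with p = \<beta> / (1 - \<beta>), up to a logarithm. As \<beta> < b amounts to p <
  1 - \<alpha>, this contradicts \<open>Re_H_lower\<close>. The shift \<open>Suc n\<close> matches
  the power of the inverse that controls \<open>c n\<close>.\<close>

lemma coeff_lower:
  assumes c: "power_series c (\<lambda>z. inverse (S \<kappa> z))" and \<kappa>: "0 < \<kappa>"
    and \<beta>: "0 < \<beta>" "\<beta> < b_exponent \<xi>" and M: "0 < M"
  shows "\<exists>n. M * exp (real (Suc n) powr \<beta>) < cmod (c n)"
proof (rule ccontr)
  assume "\<not> ?thesis"
  then have cn: "cmod (c n) \<le> M * exp (real (Suc n) powr \<beta>)" for n by (meson not_le)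
  have \<beta>1: "\<beta> < 1" using \<beta> b_exponent_bounds by linarith
  define p where "p = \<beta> / (1 - \<beta>)"
  have p: "0 < p" "p < 1 - \<alpha>"
  proof -
    show "0 < p" using \<beta> \<beta>1 by (simp add: p_def)
    have "\<beta> * (2 - \<alpha>) < 1 - \<alpha>" using \<beta>(2) alpha unfolding b_exponent_eq by (simp add: pos_less_divide_eq)
    then have "\<beta> < (1 - \<alpha>) * (1 - \<beta>)" by (simp add: algebra_simps)
    then show "p < 1 - \<alpha>" using \<beta>1 by (simp add: p_def pos_divide_less_eq)
  qed
  have bound: "exp (\<kappa> * Re (H (of_real (1 - \<delta>)))) \<le> M * exp ((2 / \<delta>) powr p) * exp 1 * (3 / \<delta>)"
    if \<delta>: "0 < \<delta>" "\<delta> < 1" for \<delta>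
  proof -
    define r where "r = 1 - \<delta>"
    \<comment> \<open>Half of the decay exp(-\<delta> n) pays for the growth of the coefficients;
      \<open>q\<close> is the ratio left over.\<close>
    define q where "q = exp (- (\<delta> / 2))"
    define B where "B = M * exp ((2 / \<delta>) powr p) * exp 1"
    have B: "0 < B" using M by (simp add: B_def)
    have r: "0 < r" "r < 1" using \<delta> by (auto simp: r_def)
    have q: "0 < q" "q < 1" using \<delta> by (auto simp: q_def)
    have coeff: "cmod (c n * of_real r ^ n) \<le> B * q ^ n" for n
    proof -
      have "real (Suc n) powr \<beta> \<le> \<delta> / 2 * real (Suc n) + (2 / \<delta>) powr p"
        unfolding p_def using \<delta> \<beta> \<beta>1 by (intro powr_le_linear) auto
      also have "\<dots> \<le> (2 / \<delta>) powr p + 1 + \<delta> / 2 * real n" using \<delta> by (simp add: algebra_simps)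
      finally have "exp (real (Suc n) powr \<beta>) \<le> exp ((2 / \<delta>) powr p + 1 + \<delta> / 2 * real n)" by simp
      also have "\<dots> = exp ((2 / \<delta>) powr p) * exp 1 * exp (\<delta> / 2) ^ n"
        by (simp add: exp_add mult.commute flip: exp_of_nat_mult)
      finally have "M * exp (real (Suc n) powr \<beta>) \<le> B * exp (\<delta> / 2) ^ n"
        using M by (simp add: B_def mult.assoc)
      with cn[of n] have cB: "cmod (c n) \<le> B * exp (\<delta> / 2) ^ n" by linarith
      have "r \<le> exp (- \<delta>)" using exp_ge_add_one_self[of "- \<delta>"] by (simp add: r_def)
      then have "exp (\<delta> / 2) * r \<le> exp (\<delta> / 2) * exp (- \<delta>)" by (intro mult_left_mono) auto
      also have "\<dots> = q" by (simp add: q_def flip: exp_add)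
      finally have rq: "(exp (\<delta> / 2) * r) ^ n \<le> q ^ n" using r by (intro power_mono) auto
      have "cmod (c n * of_real r ^ n) = cmod (c n) * r ^ n" using r by (simp add: norm_mult norm_power)
      also have "\<dots> \<le> B * exp (\<delta> / 2) ^ n * r ^ n" using cB r by (intro mult_right_mono) auto
      also have "\<dots> = B * (exp (\<delta> / 2) * r) ^ n" by (simp add: power_mult_distrib mult.assoc)
      also have "\<dots> \<le> B * q ^ n" using rq B by (intro mult_left_mono) auto
      finally show ?thesis .
    qed
    have sq: "(\<lambda>n. B * q ^ n) sums (B * (1 / (1 - q)))" using q by (intro sums_mult geometric_sums) auto
    have "complex_of_real r \<in> ball 0 1" using r by simp
    with c have "(\<lambda>n. c n * of_real r ^ n) sums inverse (S \<kappa> (of_real r))"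
      unfolding power_series_def by blast
    then have "cmod (inverse (S \<kappa> (of_real r))) = cmod (\<Sum>n. c n * of_real r ^ n)" by (simp add: sums_iff)
    also have "\<dots> \<le> (\<Sum>n. B * q ^ n)" by (rule norm_suminf_le[OF coeff sums_summable[OF sq]])
    also have "\<dots> = B * (1 / (1 - q))" using sq by (simp add: sums_iff)
    also have "\<dots> \<le> B * (3 / \<delta>)"
    proof -
      have "1 + \<delta> / 2 \<le> exp (\<delta> / 2)" by (rule exp_ge_add_one_self)
      then have "q \<le> 1 / (1 + \<delta> / 2)" using \<delta> by (simp add: q_def exp_minus field_simps)
      \<comment> \<open>Amounts to \<delta> (1 - \<delta>) \<ge> 0; the factor
        \<open>3 / \<delta>\<close> comes from here.\<close>
      also have "\<dots> \<le> 1 - \<delta> / 3" using \<delta> by (simp add: field_simps)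
      finally have "1 / (1 - q) \<le> 1 / (\<delta> / 3)" using \<delta> by (intro frac_le) auto
      then show ?thesis using B by (intro mult_left_mono) auto
    qed
    finally show ?thesis
      by (simp add: B_def r_def norm_inverse norm_S flip: exp_minus)
  qed
  define a where "a = \<kappa> / (2 * pi + 1)\<^sup>2"
  have "0 < 2 * pi + 1" using pi_gt_zero by linarith
  then have a: "0 < a" using \<kappa> unfolding a_def by (intro divide_pos_pos zero_less_power)
  define A where "A = M * exp 1 * 3"
  have A: "0 < A" using M by (simp add: A_def)
  \<comment> \<open>Here \<open>x\<close> stands for \<open>1 / \<delta>\<close>: the first term is
    the lower bound for \<kappa> Re H, the other two form the logarithm of the upper bound for
    |1/S|.\<close>
  have "filterlim (\<lambda>x. a * x powr (1 - \<alpha>) - ln (A * x) - (2 * x) powr p) at_top at_top"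
    using a A p by real_asymp
  moreover have "filterlim (\<lambda>K. (1 / \<xi>) ^ K) at_top sequentially"
  proof -
    have "(\<lambda>K. \<xi> ^ K) \<longlonglongrightarrow> 0" using xi by (intro LIMSEQ_realpow_zero) auto
    from filterlim_inverse_at_top[OF this] show ?thesis using xi by (simp add: inverse_eq_divide power_divide)
  qed
  ultimately have "filterlim (\<lambda>K. a * ((1 / \<xi>) ^ K) powr (1 - \<alpha>) - ln (A * (1 / \<xi>) ^ K) - (2 * (1 / \<xi>) ^ K) powr p)
      at_top sequentially"
    by (rule filterlim_compose)
  then have "\<forall>\<^sub>F K in sequentially. 0 < a * ((1 / \<xi>) ^ K) powr (1 - \<alpha>) - ln (A * (1 / \<xi>) ^ K) - (2 * (1 / \<xi>) ^ K) powr p"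
    unfolding filterlim_at_top_dense by blast
  then obtain K0 where K0: "\<forall>K\<ge>K0. 0 < a * ((1 / \<xi>) ^ K) powr (1 - \<alpha>) - ln (A * (1 / \<xi>) ^ K) - (2 * (1 / \<xi>) ^ K) powr p"
    unfolding eventually_sequentially by blast
  obtain K where K: "0 < K"
    and pos: "0 < a * ((1 / \<xi>) ^ K) powr (1 - \<alpha>) - ln (A * (1 / \<xi>) ^ K) - (2 * (1 / \<xi>) ^ K) powr p"
    using that[OF _ K0[rule_format, of "Suc K0"]] by (metis le_Suc_eq order_refl zero_less_Suc)
  define \<delta> where "\<delta> = \<xi> ^ K"
  have x: "(1 / \<xi>) ^ K = 1 / \<delta>" by (simp add: \<delta>_def power_divide)
  have \<delta>: "0 < \<delta>" "\<delta> < 1" using xi K by (auto simp: \<delta>_def power_less_one_iff)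
  have "a * (1 / \<delta>) powr (1 - \<alpha>) = \<kappa> * (\<delta> powr (\<alpha> - 1) / (2 * pi + 1)\<^sup>2)"
    using \<delta> by (simp add: a_def powr_divide powr_minus_divide[of \<delta> "1 - \<alpha>", simplified])
  also have "\<dots> \<le> \<kappa> * Re (H (of_real (1 - \<delta>)))"
    using Re_H_lower[OF K] \<kappa> by (intro mult_left_mono) (auto simp: \<delta>_def)
  also have "\<dots> \<le> ln (M * exp ((2 / \<delta>) powr p) * exp 1 * (3 / \<delta>))"
    using bound[OF \<delta>] M \<delta> by (subst ln_ge_iff) auto
  also have "M * exp ((2 / \<delta>) powr p) * exp 1 * (3 / \<delta>) = A * (1 / \<delta>) * exp ((2 / \<delta>) powr p)"
    by (simp add: A_def)
  also have "ln \<dots> = ln (A * (1 / \<delta>)) + (2 / \<delta>) powr p"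
    using A \<delta> by (subst ln_mult) auto
  finally show False using pos unfolding x by simp
qed

end

theorem proposition2p3:
  fixes \<xi> :: real
  assumes "0 < \<xi>" and "\<xi> < 1 / 2"
  shows "\<exists>(scale :: complex \<Rightarrow> (nat \<Rightarrow> complex) \<Rightarrow> (nat \<Rightarrow> complex)) V ip T.
    complex_hilbert_space scale V ip \<and>
    complex_inner_space.contraction scale V ip T \<and>
    complex_inner_space.spectrum scale V ip T \<subseteq> perfect_symmetric_set \<xi> \<and>
    (\<lambda>n. complex_inner_space.opnorm V ip (complex_inner_space.inv_pow V T n))
      \<in> O(\<lambda>n. exp (real n powr b_exponent \<xi>)) \<and>
    (\<forall>\<beta> < b_exponent \<xi>.
      limsup (\<lambda>n. ereal (complex_inner_space.opnorm V ip (complex_inner_space.inv_pow V T n)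
        / exp (real n powr \<beta>))) = \<infinity>)"
proof -
  interpret cantor \<xi> by unfold_locales (use assms in auto)
  define b where "b = b_exponent \<xi>"
  have b: "0 < b" using b_exponent_bounds by (simp add: b_def)
  obtain D where D: "0 < D" "\<And>z. cmod z < 1 \<Longrightarrow> Re (H z) \<le> D * (1 - cmod z) powr (\<alpha> - 1)"
    using Re_H_upper by blast
  define \<kappa> where "\<kappa> = (1/16) powr (1 - \<alpha>) / (8 * D)"
  have \<kappa>: "0 < \<kappa>" using D by (simp add: \<kappa>_def)
  obtain s c where im: "inner_model s c (S \<kappa>) (\<lambda>z. inverse (S \<kappa> z))"
    using inner_model_S[of \<kappa>] \<kappa> by auto
  interpret inner_model s c "S \<kappa>" "\<lambda>z. inverse (S \<kappa> z)" by (rule im)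
  have spec: "spectrum bshift \<subseteq> E" using spectrum_subset_E[OF im] \<kappa> by simp
  have "0 \<notin> E" using norm_circ by (metis imageE norm_zero zero_neq_one)
  with spec have 0: "0 \<notin> spectrum bshift" by blast
  have upper: "(\<lambda>n. opnorm (inv_pow bshift n)) \<in> O(\<lambda>n. exp (real n powr b))"
  proof -
    have "norm (opnorm (inv_pow bshift n)) \<le> norm (1 + real n * (real n * exp (real n powr b / 4)))" for n
    proof -
      have "opnorm (inv_pow bshift n) \<le> 1 + real n * (\<Sum>i<n. cmod (c i))"
        by (rule opnorm_inv_pow_le[OF 0])
      also have "(\<Sum>i<n. cmod (c i)) \<le> (\<Sum>i<n. exp (real n powr b / 4))"
        unfolding b_def by (intro sum_mono coeff_upper[OF D \<kappa>_def c]) auto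
      finally have "opnorm (inv_pow bshift n) \<le> 1 + real n * (real n * exp (real n powr b / 4))"
        by (simp add: mult_left_mono)
      then show ?thesis using opnorm_nonneg[OF 0 bounded_op_inv_pow[OF 0], of n] by simp
    qed
    then have "(\<lambda>n. opnorm (inv_pow bshift n)) \<in> O(\<lambda>n. 1 + real n * (real n * exp (real n powr b / 4)))"
      by (intro landau_o.big_mono always_eventually allI)
    \<comment> \<open>The factor n^2 is absorbed thanks to the 1/4 in the exponent.\<close>
    also have "(\<lambda>n. 1 + real n * (real n * exp (real n powr b / 4))) \<in> O(\<lambda>n. exp (real n powr b))"
      using b by real_asymp
    finally show ?thesis .
  qed
  have lower: "limsup (\<lambda>n. ereal (opnorm (inv_pow bshift n) / exp (real n powr \<beta>))) = \<infinity>" if "\<beta> < b" for \<beta>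
  proof (rule ccontr)
    assume "\<not> ?thesis"
    then obtain m :: nat where "limsup (\<lambda>n. ereal (opnorm (inv_pow bshift n) / exp (real n powr \<beta>))) < ereal (real m)"
      using less_PInf_Ex_of_nat by auto
    then have "\<forall>\<^sub>F n in sequentially. ereal (opnorm (inv_pow bshift n) / exp (real n powr \<beta>)) < ereal (real m)"
      by (rule Limsup_lessD)
    then obtain n0 where n0: "\<And>n. n \<ge> n0 \<Longrightarrow> opnorm (inv_pow bshift n) < real m * exp (real n powr \<beta>)"
      by (auto simp: eventually_sequentially pos_divide_less_eq)
    \<comment> \<open>\<open>coeff_lower\<close> asks for a positive exponent; the maximum brings
      \<beta> \<le> 0 under it as well.\<close>
    define \<gamma> where "\<gamma> = max \<beta> (b / 2)"
    have \<gamma>: "0 < \<gamma>" "\<gamma> < b" using that b by (auto simp: \<gamma>_def)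
    \<comment> \<open>The sum takes care of the indices up to \<open>n0\<close>, and
      \<open>m\<close> of all later ones.\<close>
    define M where "M = 1 + real m + (\<Sum>i\<le>n0. cmod (c i))"
    have M: "0 < M" by (simp add: M_def add_pos_nonneg sum_nonneg)
    have "cmod (c n) \<le> M * exp (real (Suc n) powr \<gamma>)" for n
    proof (cases "n \<le> n0")
      case True
      have "cmod (c n) \<le> (\<Sum>i\<le>n0. cmod (c i))" using True by (intro member_le_sum) auto
      also have "\<dots> \<le> M * 1" by (simp add: M_def)
      also have "\<dots> \<le> M * exp (real (Suc n) powr \<gamma>)" using M by (intro mult_left_mono) auto
      finally show ?thesis .
    next
      case False
      \<comment> \<open>Index 0 belongs to the previous case, so \<open>n\<close> is a successor,
        the form in which \<open>opnorm_inv_pow_ge\<close> applies.\<close>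
      then obtain k where k: "n = Suc k" "n0 \<le> Suc (Suc k)" by (cases n) auto
      have "cmod (c n) \<le> opnorm (inv_pow bshift (Suc n))" unfolding k(1) by (rule opnorm_inv_pow_ge[OF 0])
      also have "\<dots> \<le> real m * exp (real (Suc n) powr \<beta>)" using n0[of "Suc n"] k by simp
      also have "\<dots> \<le> M * exp (real (Suc n) powr \<gamma>)"
        by (intro mult_mono) (auto simp: M_def sum_nonneg \<gamma>_def add_increasing2 intro!: powr_mono)
      finally show ?thesis .
    qed
    moreover obtain n where "M * exp (real (Suc n) powr \<gamma>) < cmod (c n)"
      using coeff_lower[OF c \<kappa> \<gamma>(1) _ M] \<gamma>(2) by (auto simp: b_def)
    ultimately show False by (meson not_le)
  qed
  show ?thesis
  proof (intro exI conjI allI impI)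
    show "complex_hilbert_space l2_scale_op (model_space s) l2_ip" by (rule complex_hilbert_space_axioms)
    show "contraction bshift" by (rule contraction_bshift)
    show "spectrum bshift \<subseteq> perfect_symmetric_set \<xi>" using spec circ_cantor_set_subset by blast
    show "(\<lambda>n. opnorm (inv_pow bshift n)) \<in> O(\<lambda>n. exp (real n powr b_exponent \<xi>))"
      using upper by (simp add: b_def)
    show "limsup (\<lambda>n. ereal (opnorm (inv_pow bshift n) / exp (real n powr \<beta>))) = \<infinity>"
      if "\<beta> < b_exponent \<xi>" for \<beta>
      using lower that by (simp add: b_def)
  qed
qed

end
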